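(* Let $\omega$ be a probability distribution on $(0,1)$ such that: (i) $\omega$ is not supported by a geometric sequence, i.e. there is no $x\in(0,1)$ with $\omega(\{1-x^j:j=1,2,\ldots\})=1$; (ii) $\int_0^1|\log x|\,\omega(\mathrm{d}x)<\infty$; (iii) $\nu:=\int_0^1(\log(1-x))^2\,\omega(\mathrm{d}x)<\infty$. Put $\mu:=\int_0^1|\log(1-x)|\,\omega(\mathrm{d}x)$ and $\sigma^2:=\nu-\mu^2$. Then, as $n\to\infty$, $$\mathrm{Var}\,K_n\sim\frac{\sigma^2}{\mu^3}\,\log n .$$
   Context: Definition of $K_n$: let $X_1,X_2,\ldots$ be i.i.d. with distribution $\omega$, and let $U_1,U_2,\ldots$ be i.i.d. uniform on $[0,1]$, independent of $(X_j)$. Put $P_0=0$ and $P_j=1-\prod_{i=1}^j(1-X_i)$. Then $K_n$ is the number of $j\ge1$ such that the interval $(P_{j-1},P_j)$ contains at least one of $U_1,\ldots,U_n$. *)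

theory Defs
  imports "HOL-Probability.Probability" "HOL-Library.Landau_Symbols"
begin

(* Sequences are indexed from 1; the values X 0 and U 0 are never used. *)

definition stick_point :: "(nat \<Rightarrow> 'a \<Rightarrow> real) \<Rightarrow> nat \<Rightarrow> 'a \<Rightarrow> real" where
  "stick_point X j w = 1 - (\<Prod>i=1..j. (1 - X i w))"

(* If all X i w lie in (0,1), the intervals are pairwise disjoint, so the set below has at
   most n elements. It can be infinite (with card 0) only on the null event that some X i w
   lies outside (0,1). *)
definition num_occupied ::
    "(nat \<Rightarrow> 'a \<Rightarrow> real) \<Rightarrow> (nat \<Rightarrow> 'a \<Rightarrow> real) \<Rightarrow> nat \<Rightarrow> 'a \<Rightarrow> nat" where
  "num_occupied X U n w =
     card {j. 1 \<le> j \<and> (\<exists>i\<in>{1..n}. U i w \<in> {stick_point X (j - 1) w<..<stick_point X j w})}"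

end

theory Submission
  imports Defs
begin

text \<open>
  In the coordinate \<open>y = - ln (1 - x)\<close> the breaking points become a random walk \<open>S\<close> with i.i.d. positive
  steps \<open>\<xi>\<^sub>j = - ln (1 - X\<^sub>j)\<close>, of mean \<open>\<mu>\<close> and variance \<open>\<sigma>2\<close>, and the deepest of \<open>n\<close> balls sits near
  \<open>t = ln n\<close>. Hence \<open>K\<^sub>n\<close> should differ little from the number \<open>\<tau>\<close> of indices \<open>k \<ge> 0\<close> with \<open>S\<^sub>k \<le> t\<close>, and
  the variance of a renewal count is known to grow like \<open>\<sigma>2 t / \<mu>\<^sup>3\<close>. The proof makes both statements
  quantitative in mean square, with no renewal theorem beyond an elementary bound.

  \<^item> The number of empty intervals that start before \<open>t\<close> is bounded in mean square. Given the walk,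
    several fixed intervals are all empty with probability at most
    the product of \<open>exp (- n p)\<close> over their lengths \<open>p\<close> (\<open>expectation_gaps_le\<close>), and
    \<open>n p = exp (t - S\<^sub>k) X\<^bsub>k+1\<^esub>\<close>. Summing over \<open>k\<close> with the renewal bound costs a multiple of the
    expectation of \<open>ln (1 + 1 / X)\<close>, which is finite by the integrability of \<open>\<bar>ln x\<bar>\<close>; that the
    renewal bound holds conditionally on the past gives the second moment as well
    (\<open>gap_potential_bound\<close>, \<open>gap_count_second_moment\<close>). The occupied intervals that start beyond \<open>t\<close>
    are at most as many as the balls above \<open>1 - 1 / n\<close>, again bounded in mean square.

  \<^item> The renewal bound: jumps of size at least \<open>d\<close> leave an interval of length \<open>d\<close> for ever, so at most
    one such jump starts there. As each jump is that large with probability \<open>q\<close> independently of the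
    past, the expected number of visits to the interval is at most \<open>1 / q\<close> (\<open>renewal_bound\<close>).

  \<^item> By the Wald identities the sum \<open>F\<close> of \<open>\<xi>\<^bsub>k+1\<^esub> - \<mu>\<close> over \<open>k\<close> with \<open>S\<^sub>k \<le> t\<close> is centred with variance
    \<open>\<sigma>2\<close> times the mean of \<open>\<tau>\<close> (\<open>fluctuation_moments\<close>), and \<open>\<mu> \<tau> + F - t\<close> is the overshoot over \<open>t\<close>.
    The square of the overshoot has expectation \<open>o(t)\<close>, because it is at most \<open>c\<^sup>2\<close> plus the squares of all
    steps larger than \<open>c\<close> made before passage (\<open>overshoot_bound\<close>). So \<open>\<tau>\<close> has mean asymptotic to \<open>t / \<mu>\<close>,
    and \<open>K\<^sub>n\<close> equals \<open>t / \<mu> - F / \<mu>\<close> up to an error of size \<open>o(\<surd>t)\<close> in mean square. Such an error does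
    not affect the leading term of the variance (\<open>tendsto_variance_ratio\<close>).

  All sums over \<open>k\<close> are cut off at an index \<open>J\<close>, depending on \<open>n\<close>, so large that \<open>S\<^sub>J \<le> t\<close> has probability
  at most \<open>1 / (n\<^sup>2 + t\<^sup>2)\<close>; thus no infinite sum of random variables occurs. Finally
  \<open>\<sigma>2\<close> is nonzero, since a law concentrated in one point is supported by a geometric sequence.
\<close>

section \<open>Second moments and variances of perturbed sequences\<close>

lemma (in prob_space) integrable_mult_of_square_integrable:
  fixes f g :: "'a \<Rightarrow> real"
  assumes [measurable]: "f \<in> borel_measurable M" "g \<in> borel_measurable M"
    and f: "integrable M (\<lambda>w. (f w)\<^sup>2)" and g: "integrable M (\<lambda>w. (g w)\<^sup>2)"
  shows "integrable M (\<lambda>w. f w * g w)"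
proof (rule Bochner_Integration.integrable_bound)
  show "integrable M (\<lambda>w. (f w)\<^sup>2 + (g w)\<^sup>2)" using f g by simp
  have "\<bar>a * b\<bar> \<le> a\<^sup>2 + b\<^sup>2" for a b :: real
  proof -
    have "0 \<le> (\<bar>a\<bar> - \<bar>b\<bar>)\<^sup>2" by simp
    then have "2 * (\<bar>a\<bar> * \<bar>b\<bar>) \<le> a\<^sup>2 + b\<^sup>2" by (simp add: power2_diff)
    moreover have "0 \<le> \<bar>a\<bar> * \<bar>b\<bar>" by simp
    ultimately show ?thesis unfolding abs_mult by linarith
  qed
  then show "AE w in M. norm (f w * g w) \<le> norm ((f w)\<^sup>2 + (g w)\<^sup>2)" by simp
qed simp

lemma (in prob_space) integrable_of_square_integrable:
  fixes f :: "'a \<Rightarrow> real"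
  assumes "f \<in> borel_measurable M" "integrable M (\<lambda>w. (f w)\<^sup>2)"
  shows "integrable M f"
  using integrable_mult_of_square_integrable[of f "\<lambda>_. 1"] assms by simp

lemma (in prob_space) integrable_square_add:
  fixes f g :: "'a \<Rightarrow> real"
  assumes [measurable]: "f \<in> borel_measurable M" "g \<in> borel_measurable M"
    and f: "integrable M (\<lambda>w. (f w)\<^sup>2)" and g: "integrable M (\<lambda>w. (g w)\<^sup>2)"
  shows "integrable M (\<lambda>w. (f w + g w)\<^sup>2)"
  using f g integrable_mult_of_square_integrable[OF assms]
  by (simp add: power2_sum mult.assoc)

lemma (in prob_space) Cauchy_Schwarz_expectation:
  fixes f g :: "'a \<Rightarrow> real"
  assumes [measurable]: "f \<in> borel_measurable M" "g \<in> borel_measurable M"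
    and f: "integrable M (\<lambda>w. (f w)\<^sup>2)" and g: "integrable M (\<lambda>w. (g w)\<^sup>2)"
  shows "\<bar>expectation (\<lambda>w. f w * g w)\<bar>
    \<le> sqrt (expectation (\<lambda>w. (f w)\<^sup>2)) * sqrt (expectation (\<lambda>w. (g w)\<^sup>2))"
proof -
  define a b c where "a = expectation (\<lambda>w. (f w)\<^sup>2)" and "b = expectation (\<lambda>w. f w * g w)"
    and "c = expectation (\<lambda>w. (g w)\<^sup>2)"
  have fg: "integrable M (\<lambda>w. f w * g w)"
    by (rule integrable_mult_of_square_integrable) (use assms in auto)
  have quad: "0 \<le> x\<^sup>2 * a + 2 * x * b + c" for x
  proof -
    have "0 \<le> expectation (\<lambda>w. (x * f w + g w)\<^sup>2)" by simp
    also have "(\<lambda>w. (x * f w + g w)\<^sup>2)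
        = (\<lambda>w. x\<^sup>2 * (f w)\<^sup>2 + (2 * x) * (f w * g w) + (g w)\<^sup>2)"
      by (auto simp: power2_sum power_mult_distrib algebra_simps)
    also have "expectation \<dots> = x\<^sup>2 * a + 2 * x * b + c"
      using f g fg by (simp add: a_def b_def c_def)
    finally show ?thesis .
  qed
  have a0: "a \<ge> 0" "c \<ge> 0" by (simp_all add: a_def c_def)
  have "b\<^sup>2 \<le> a * c"
  proof (cases "a = 0")
    case True
    have "b = 0"
    proof (rule ccontr)
      assume "b \<noteq> 0"
      then show False using quad[of "- (c + 1) / (2 * b)"] True by (simp add: field_simps)
    qed
    then show ?thesis using True by simp
  next
    case False
    then have "a > 0" using a0 by simp
    have "0 \<le> a * ((- b / a)\<^sup>2 * a + 2 * (- b / a) * b + c)"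
      using quad[of "- b / a"] \<open>a > 0\<close> by simp
    also have "\<dots> = a * c - b\<^sup>2" using False by (simp add: field_simps power2_eq_square)
    finally show ?thesis by simp
  qed
  then have "sqrt (b\<^sup>2) \<le> sqrt (a * c)" by (rule real_sqrt_le_mono)
  then show ?thesis by (simp add: real_sqrt_mult a_def b_def c_def)
qed

text \<open>
  The error is negligible against the centred part \<open>Z\<close>: its own second moment is \<open>o(a)\<close>, and by
  Cauchy-Schwarz its covariance with \<open>Z\<close>, whose second moment is \<open>O(a)\<close>, is \<open>o(a)\<close> too. The
  deterministic part \<open>b\<close> may be arbitrarily large, as a variance does not see it.
\<close>

lemma (in prob_space) tendsto_variance_ratio:
  fixes K Z :: "nat \<Rightarrow> 'a \<Rightarrow> real" and a b :: "nat \<Rightarrow> real"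
  assumes [measurable]: "\<And>n. K n \<in> borel_measurable M" "\<And>n. Z n \<in> borel_measurable M"
    and K: "\<And>n. integrable M (\<lambda>w. (K n w)\<^sup>2)" and Z: "\<And>n. integrable M (\<lambda>w. (Z n w)\<^sup>2)"
    and Z_mean: "\<And>n. expectation (Z n) = 0"
    and a: "\<forall>\<^sub>F n in sequentially. a n > 0"
    and Z_lim: "(\<lambda>n. expectation (\<lambda>w. (Z n w)\<^sup>2) / a n) \<longlonglongrightarrow> L"
    and err: "(\<lambda>n. expectation (\<lambda>w. (K n w - b n - Z n w)\<^sup>2) / a n) \<longlonglongrightarrow> 0"
  shows "(\<lambda>n. variance (K n) / a n) \<longlonglongrightarrow> L"
proof -
  define e where "e n w = K n w - b n - Z n w" for n w
  have [measurable]: "e n \<in> borel_measurable M" for n unfolding e_def by measurable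
  have Z': "integrable M (\<lambda>w. (- Z n w)\<^sup>2)" for n using Z by simp
  have e2: "integrable M (\<lambda>w. (e n w)\<^sup>2)" for n
  proof -
    have "integrable M (\<lambda>w. (K n w + - b n)\<^sup>2)" by (rule integrable_square_add) (use K in auto)
    from integrable_square_add[OF _ _ this Z'[of n]] show ?thesis by (simp add: e_def)
  qed
  have Z1: "integrable M (Z n)" for n by (rule integrable_of_square_integrable) (use Z in auto)
  have e1: "integrable M (e n)" for n by (rule integrable_of_square_integrable) (use e2 in auto)
  have Ze: "integrable M (\<lambda>w. Z n w * e n w)" for n
    by (intro integrable_mult_of_square_integrable) (use Z e2 in auto)
  define A B C where "A n = expectation (\<lambda>w. (Z n w)\<^sup>2)" and "B n = expectation (\<lambda>w. Z n w * e n w)"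
    and "C n = expectation (\<lambda>w. (e n w)\<^sup>2)" for n
  have AC: "A n \<ge> 0" "C n \<ge> 0" for n by (simp_all add: A_def C_def)
  have var: "variance (K n) = A n + 2 * B n + C n - (expectation (e n))\<^sup>2" for n
  proof -
    define m where "m = expectation (e n)"
    have K_eq: "K n = (\<lambda>w. b n + (Z n w + e n w))" by (auto simp: e_def)
    have "expectation (K n) = b n + m"
      unfolding K_eq using Z1 e1 by (simp add: Z_mean m_def prob_space)
    then have "variance (K n) = expectation (\<lambda>w. (Z n w + e n w - m)\<^sup>2)"
      by (simp add: K_eq)
    also have "(\<lambda>w. (Z n w + e n w - m)\<^sup>2) = (\<lambda>w. (Z n w)\<^sup>2 + 2 * (Z n w * e n w) + (e n w)\<^sup>2
        - (2 * m) * Z n w - (2 * m) * e n w + m\<^sup>2)"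
      by (auto simp: power2_eq_square algebra_simps)
    also have "expectation \<dots> = A n + 2 * B n + C n - (2 * m) * 0 - (2 * m) * m + m\<^sup>2"
      using Z e2 Ze Z1 e1 by (simp add: A_def B_def C_def Z_mean m_def prob_space)
    finally show ?thesis by (simp add: m_def power2_eq_square)
  qed
  have C0: "(\<lambda>n. C n / a n) \<longlonglongrightarrow> 0" using err by (simp add: C_def e_def)
  have A0: "(\<lambda>n. A n / a n) \<longlonglongrightarrow> L" using Z_lim by (simp add: A_def)
  have B0: "(\<lambda>n. B n / a n) \<longlonglongrightarrow> 0"
  proof (rule Lim_null_comparison)
    have "(\<lambda>n. sqrt (A n / a n) * sqrt (C n / a n)) \<longlonglongrightarrow> sqrt L * sqrt 0"
      by (intro tendsto_intros A0 C0)
    then show "(\<lambda>n. sqrt (A n / a n) * sqrt (C n / a n)) \<longlonglongrightarrow> 0" by simp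
    show "\<forall>\<^sub>F n in sequentially. norm (B n / a n) \<le> sqrt (A n / a n) * sqrt (C n / a n)"
      using a
    proof eventually_elim
      case (elim n)
      have "\<bar>B n\<bar> \<le> sqrt (A n) * sqrt (C n)" unfolding A_def B_def C_def
        by (rule Cauchy_Schwarz_expectation) (use Z e2 in auto)
      then have "\<bar>B n\<bar> / a n \<le> sqrt (A n) * sqrt (C n) / (sqrt (a n) * sqrt (a n))"
        using elim by (simp add: divide_right_mono)
      then show ?case using elim by (simp add: real_sqrt_divide)
    qed
  qed
  have D0: "(\<lambda>n. (expectation (e n))\<^sup>2 / a n) \<longlonglongrightarrow> 0"
  proof (rule Lim_null_comparison[OF _ C0])
    show "\<forall>\<^sub>F n in sequentially. norm ((expectation (e n))\<^sup>2 / a n) \<le> C n / a n"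
      using a
    proof eventually_elim
      case (elim n)
      have "\<bar>expectation (\<lambda>w. e n w * 1)\<bar> \<le> sqrt (C n) * sqrt (expectation (\<lambda>w. 1\<^sup>2))"
        unfolding C_def by (rule Cauchy_Schwarz_expectation) (use e2 in auto)
      then have "\<bar>expectation (e n)\<bar> \<le> sqrt (C n)" by (simp add: prob_space)
      then have "\<bar>expectation (e n)\<bar>\<^sup>2 \<le> (sqrt (C n))\<^sup>2" by (intro power_mono) auto
      then show ?case using elim AC by (simp add: divide_right_mono)
    qed
  qed
  have "(\<lambda>n. A n / a n + 2 * (B n / a n) + C n / a n - (expectation (e n))\<^sup>2 / a n)
      \<longlonglongrightarrow> L + 2 * 0 + 0 - 0"
    by (intro tendsto_intros A0 B0 C0 D0)
  then show ?thesis by (simp add: var add_divide_distrib diff_divide_distrib)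
qed

section \<open>Renewal estimates for walks with positive steps\<close>

lemma sum_of_bool_le_1:
  assumes "finite I"
    and "\<And>i j. i \<in> I \<Longrightarrow> j \<in> I \<Longrightarrow> P i \<Longrightarrow> P j \<Longrightarrow> i = j"
  shows "(\<Sum>i\<in>I. of_bool (P i) :: real) \<le> 1"
proof -
  have "card {i \<in> I. P i} \<le> Suc 0"
    using assms by (subst card_le_Suc0_iff_eq) auto
  then show ?thesis using assms(1) by (simp add: Int_def)
qed

text \<open>
  Steps are indexed from 1, so that \<open>\<xi> (Suc k)\<close> leads from \<open>S k\<close> to \<open>S (Suc k)\<close>. Positivity is required at
  every sample point, which makes all path arguments below valid without exceptional sets.
\<close>

locale positive_walk = prob_space +
  fixes \<xi> :: "nat \<Rightarrow> 'a \<Rightarrow> real"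
  assumes indep: "indep_vars (\<lambda>_. borel) \<xi> {1..}"
    and ident: "\<And>k. distr M borel (\<xi> (Suc k)) = distr M borel (\<xi> 1)"
    and step_pos: "\<And>k w. w \<in> space M \<Longrightarrow> \<xi> (Suc k) w > 0"
    and square_integrable: "integrable M (\<lambda>w. (\<xi> 1 w)\<^sup>2)"
begin

definition S :: "nat \<Rightarrow> 'a \<Rightarrow> real" where
  "S k w = (\<Sum>i<k. \<xi> (Suc i) w)"

text \<open>
  The filtration of the walk is represented by measure spaces that matter only through their
  \<open>\<sigma>\<close>-algebra, so that a quantity depending on the first \<open>k\<close> steps is just a function measurable
  with respect to \<open>past k\<close>.
\<close>

definition past :: "nat \<Rightarrow> 'a measure" where
  "past k = vimage_algebra (space M) (\<lambda>w. \<lambda>i\<in>{1..k}. \<xi> i w) (PiM {1..k} (\<lambda>_. borel))"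

lemma step_measurable [measurable]: "\<xi> (Suc k) \<in> borel_measurable M"
proof -
  have "\<forall>i\<in>{1..}. random_variable borel (\<xi> i)"
    using indep unfolding indep_vars_def by (rule conjunct1)
  then show ?thesis by auto
qed

lemma step_measurable_1 [measurable]: "\<xi> 1 \<in> borel_measurable M"
  using step_measurable[of 0] by simp

lemma expectation_step:
  fixes g :: "real \<Rightarrow> real"
  assumes [measurable]: "g \<in> borel_measurable borel"
  shows "expectation (\<lambda>w. g (\<xi> (Suc k) w)) = expectation (\<lambda>w. g (\<xi> 1 w))"
proof -
  have "expectation (\<lambda>w. g (\<xi> (Suc k) w)) = integral\<^sup>L (distr M borel (\<xi> (Suc k))) g"
    by (rule integral_distr[symmetric]) auto
  also have "\<dots> = integral\<^sup>L (distr M borel (\<xi> 1)) g" by (simp only: ident)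
  also have "\<dots> = expectation (\<lambda>w. g (\<xi> 1 w))"
    by (rule integral_distr) auto
  finally show ?thesis .
qed

lemma integrable_step:
  fixes g :: "real \<Rightarrow> real"
  assumes [measurable]: "g \<in> borel_measurable borel" and g: "integrable M (\<lambda>w. g (\<xi> 1 w))"
  shows "integrable M (\<lambda>w. g (\<xi> (Suc k) w))"
proof -
  have "integrable (distr M borel (\<xi> 1)) g" using g by (subst integrable_distr_eq) auto
  then have "integrable (distr M borel (\<xi> (Suc k))) g" by (simp only: ident)
  then show ?thesis by (subst (asm) integrable_distr_eq) auto
qed

lemma space_past [simp]: "space (past k) = space M"
  by (simp add: past_def)

lemma restrict_steps_measurable:
  "(\<lambda>w. \<lambda>i\<in>{1..k}. \<xi> i w) \<in> M \<rightarrow>\<^sub>M PiM {1..k} (\<lambda>_. borel)"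
  proof (rule measurable_restrict)
  fix i assume "i \<in> {1..k}"
  then show "random_variable borel (\<xi> i)" using step_measurable[of "i - 1"] by simp
qed

lemma restrict_steps_in_space:
  "(\<lambda>w. \<lambda>i\<in>{1..k}. \<xi> i w) \<in> space M \<rightarrow> space (PiM {1..k} (\<lambda>_. borel))"
  by (rule funcsetI, rule measurable_space[OF restrict_steps_measurable])

lemma sets_past: "sets (past k) =
    {(\<lambda>w. \<lambda>i\<in>{1..k}. \<xi> i w) -` A \<inter> space M | A. A \<in> sets (PiM {1..k} (\<lambda>_. borel))}"
  unfolding past_def
  by (rule sets_vimage_algebra2[OF restrict_steps_in_space])

lemma step_measurable_past: "i < k \<Longrightarrow> \<xi> (Suc i) \<in> borel_measurable (past k)"
proof -
  assume "i < k"
  have "(\<lambda>w. \<lambda>i\<in>{1..k}. \<xi> i w) \<in> past k \<rightarrow>\<^sub>M PiM {1..k} (\<lambda>_. borel)"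
    unfolding past_def
    by (rule measurable_vimage_algebra1[OF restrict_steps_in_space])
  from measurable_compose[OF this measurable_component_singleton[of "Suc i"]] \<open>i < k\<close>
  have "(\<lambda>w. (\<lambda>i\<in>{1..k}. \<xi> i w) (Suc i)) \<in> borel_measurable (past k)"
    by simp
  then show ?thesis using \<open>i < k\<close> by simp
qed

lemma S_measurable_past: "j \<le> k \<Longrightarrow> S j \<in> borel_measurable (past k)"
  unfolding S_def by (intro borel_measurable_sum step_measurable_past) auto

lemma sets_past_mono: "j \<le> k \<Longrightarrow> sets (past j) \<subseteq> sets (past k)"
proof -
  assume "j \<le> k"
  have "(\<lambda>w. \<lambda>i\<in>{1..j}. \<xi> i w) \<in> past k \<rightarrow>\<^sub>M PiM {1..j} (\<lambda>_. borel)"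
  proof (rule measurable_restrict)
    fix i assume "i \<in> {1..j}"
    then obtain i' where "i = Suc i'" "i' < k" using \<open>j \<le> k\<close> by (cases i) auto
    then show "\<xi> i \<in> borel_measurable (past k)" using step_measurable_past by simp
  qed
  from measurable_sets[OF this] show ?thesis by (auto simp: sets_past[of j])
qed

lemma borel_measurable_past_mono:
  fixes Y :: "'a \<Rightarrow> real"
  shows "j \<le> k \<Longrightarrow> Y \<in> borel_measurable (past j) \<Longrightarrow> Y \<in> borel_measurable (past k)"
  using sets_past_mono[of j k] unfolding measurable_def by auto

lemma borel_measurable_of_past:
  fixes Y :: "'a \<Rightarrow> real"
  shows "Y \<in> borel_measurable (past k) \<Longrightarrow> Y \<in> borel_measurable M"
  using measurable_sets[OF restrict_steps_measurable[of k]] unfolding measurable_def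
  by (auto simp: sets_past)

lemma S_measurable [measurable]: "S k \<in> borel_measurable M"
  unfolding S_def by measurable

lemma indep_past_step:
  fixes Y :: "'a \<Rightarrow> real"
  assumes Y: "Y \<in> borel_measurable (past k)" and [measurable]: "g \<in> borel_measurable borel"
  shows "indep_var borel Y borel (\<lambda>w. g (\<xi> (Suc k) w) :: real)"
proof -
  have "indep_var (PiM {1..k} (\<lambda>_. borel)) (\<lambda>w. restrict (\<lambda>i. \<xi> i w) {1..k})
      (PiM {Suc k} (\<lambda>_. borel)) (\<lambda>w. restrict (\<lambda>i. \<xi> i w) {Suc k})"
    by (rule indep_var_restrict[OF indep]) auto
  then have ind: "indep_set (sigma_sets (space M) (sets (past k)))
      (sigma_sets (space M) {(\<lambda>w. restrict (\<lambda>i. \<xi> i w) {Suc k}) -` A \<inter> space M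
        | A. A \<in> sets (PiM {Suc k} (\<lambda>_. borel))})"
    (is "indep_set _ ?F")
    unfolding indep_var_eq sets_past by blast
  have Y_sub: "sigma_sets (space M) {Y -` A \<inter> space M | A. A \<in> sets borel}
      \<subseteq> sigma_sets (space M) (sets (past k))"
    using measurable_sets[OF Y] by (intro sigma_sets_mono') auto
  have "{(\<lambda>w. g (\<xi> (Suc k) w)) -` A \<inter> space M | A. A \<in> sets borel} \<subseteq> ?F"
  proof clarify
    fix A :: "real set" assume [measurable]: "A \<in> sets borel"
    have "(\<lambda>x. g (x (Suc k))) \<in> borel_measurable (PiM {Suc k} (\<lambda>_. borel))"
      by measurable
    from measurable_sets[OF this, of A]
    have "(\<lambda>x. g (x (Suc k))) -` A \<inter> space (PiM {Suc k} (\<lambda>_. borel))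
        \<in> sets (PiM {Suc k} (\<lambda>_. borel))" by simp
    moreover have "(\<lambda>w. g (\<xi> (Suc k) w)) -` A \<inter> space M
      = (\<lambda>w. restrict (\<lambda>i. \<xi> i w) {Suc k}) -`
          ((\<lambda>x. g (x (Suc k))) -` A \<inter> space (PiM {Suc k} (\<lambda>_. borel))) \<inter> space M"
      by (auto simp: space_PiM)
    ultimately show "(\<lambda>w. g (\<xi> (Suc k) w)) -` A \<inter> space M \<in> ?F"
      by (intro sigma_sets.Basic) blast
  qed
  then have "sigma_sets (space M) {(\<lambda>w. g (\<xi> (Suc k) w)) -` A \<inter> space M | A. A \<in> sets borel}
      \<subseteq> ?F"
    by (rule sigma_sets_mono)
  with ind Y_sub have "indep_set (sigma_sets (space M) {Y -` A \<inter> space M | A. A \<in> sets borel})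
      (sigma_sets (space M) {(\<lambda>w. g (\<xi> (Suc k) w)) -` A \<inter> space M | A. A \<in> sets borel})"
    unfolding indep_sets2_eq by blast
  then show ?thesis
    unfolding indep_var_eq using borel_measurable_of_past[OF Y] by simp
qed

lemma expectation_past_step:
  fixes Y :: "'a \<Rightarrow> real"
  assumes Y: "Y \<in> borel_measurable (past k)" "integrable M Y"
    and [measurable]: "g \<in> borel_measurable borel" and g: "integrable M (\<lambda>w. g (\<xi> 1 w) :: real)"
  shows "expectation (\<lambda>w. Y w * g (\<xi> (Suc k) w)) = expectation Y * expectation (\<lambda>w. g (\<xi> 1 w))"
    and "integrable M (\<lambda>w. Y w * g (\<xi> (Suc k) w))"
proof -
  have gi: "integrable M (\<lambda>w. g (\<xi> (Suc k) w))" by (rule integrable_step) (use g in auto)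
  note ind = indep_past_step[OF Y(1) \<open>g \<in> borel_measurable borel\<close>]
  show "expectation (\<lambda>w. Y w * g (\<xi> (Suc k) w)) = expectation Y * expectation (\<lambda>w. g (\<xi> 1 w))"
    using indep_var_lebesgue_integral[OF ind Y(2) gi] by (simp only: expectation_step[OF assms(3), of k])
  show "integrable M (\<lambda>w. Y w * g (\<xi> (Suc k) w))"
    by (rule indep_var_integrable[OF ind Y(2) gi])
qed

lemma S_0 [simp]: "S 0 w = 0"
  by (simp add: S_def)

lemma S_Suc: "S (Suc k) w = S k w + \<xi> (Suc k) w"
  by (simp add: S_def)

lemma S_mono: "w \<in> space M \<Longrightarrow> j \<le> k \<Longrightarrow> S j w \<le> S k w"
  by (rule lift_Suc_mono_le[of "\<lambda>k. S k w"]) (use step_pos in \<open>auto simp: S_Suc less_imp_le\<close>)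

lemma S_nonneg: "w \<in> space M \<Longrightarrow> 0 \<le> S k w"
  using S_mono[of w 0 k] by simp

lemma past_times_indicator:
  fixes Y :: "'a \<Rightarrow> real"
  assumes Y: "Y \<in> borel_measurable (past i)" "integrable M Y" and "i \<le> k" and [measurable]: "A \<in> sets borel"
  shows "(\<lambda>w. Y w * indicator A (S k w)) \<in> borel_measurable (past k)"
    "integrable M (\<lambda>w. Y w * indicator A (S k w))"
proof -
  note [measurable] = borel_measurable_past_mono[OF \<open>i \<le> k\<close> Y(1)] S_measurable_past[OF order_refl, of k]
    borel_measurable_of_past[OF Y(1)]
  show "(\<lambda>w. Y w * indicator A (S k w)) \<in> borel_measurable (past k)"
    by measurable
  show "integrable M (\<lambda>w. Y w * indicator A (S k w))"
    by (rule Bochner_Integration.integrable_bound[OF Y(2)]) (auto simp: indicator_def)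
qed

text \<open>
  A step of size at least \<open>d\<close> from the interval \<open>{u<..u + d}\<close> carries the increasing walk beyond it for
  good, so the interval contains the starting point of at most one such step. Whether the next step
  is that large is independent of the past; taking expectations yields the bound. The weight \<open>Y\<close>,
  known at time \<open>i\<close>, allows the bound to be applied conditionally on the first \<open>i\<close> steps.
\<close>

lemma renewal_bound:
  fixes Y :: "'a \<Rightarrow> real"
  assumes Y: "Y \<in> borel_measurable (past i)" "integrable M Y" "\<And>w. w \<in> space M \<Longrightarrow> 0 \<le> Y w"
  shows "prob {w \<in> space M. d \<le> \<xi> 1 w}
      * (\<Sum>k\<in>{i..<J}. expectation (\<lambda>w. Y w * indicator {u<..u + d} (S k w))) \<le> expectation Y"
proof -
  let ?A = "{u<..u + d}"
  let ?f = "\<lambda>k w. Y w * indicator ?A (S k w) * indicator {d..} (\<xi> (Suc k) w)"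
  have g: "integrable M (\<lambda>w. indicator {d..} (\<xi> 1 w) :: real)"
    by (rule integrable_const_bound[of _ 1]) (auto simp: indicator_def)
  have q: "expectation (\<lambda>w. indicat_real {d..} (\<xi> 1 w)) = prob {w \<in> space M. d \<le> \<xi> 1 w}"
  proof -
    have "expectation (\<lambda>w. indicat_real {d..} (\<xi> 1 w)) = expectation (indicat_real {w \<in> space M. d \<le> \<xi> 1 w})"
      by (rule Bochner_Integration.integral_cong) (auto simp: indicator_def)
    then show ?thesis by simp
  qed
  have f: "expectation (?f k) = expectation (\<lambda>w. Y w * indicator ?A (S k w)) * prob {w \<in> space M. d \<le> \<xi> 1 w}"
    "integrable M (?f k)" if "k \<in> {i..<J}" for k
    using expectation_past_step[OF past_times_indicator[OF Y(1,2), of k ?A], of "indicator {d..}"] that g q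
    by auto
  have "prob {w \<in> space M. d \<le> \<xi> 1 w}
      * (\<Sum>k\<in>{i..<J}. expectation (\<lambda>w. Y w * indicator ?A (S k w))) = (\<Sum>k\<in>{i..<J}. expectation (?f k))"
    using f(1) by (simp add: sum_distrib_left mult.commute)
  also have "\<dots> = expectation (\<lambda>w. \<Sum>k\<in>{i..<J}. ?f k w)"
    using f(2) by (intro Bochner_Integration.integral_sum[symmetric]) auto
  also have "\<dots> \<le> expectation Y"
  proof (rule integral_mono)
    show "integrable M (\<lambda>w. \<Sum>k\<in>{i..<J}. ?f k w)" using f(2) by (intro Bochner_Integration.integrable_sum) auto
    fix w assume w: "w \<in> space M"
    let ?P = "\<lambda>k. u < S k w \<and> S k w \<le> u + d \<and> d \<le> \<xi> (Suc k) w"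
    have less: False if "?P j" "?P k" "j < k" for j k
      using S_mono[OF w, of "Suc j" k] that by (auto simp: S_Suc)
    have "(\<Sum>k\<in>{i..<J}. of_bool (?P k) :: real) \<le> 1"
      by (rule sum_of_bool_le_1[OF finite_atLeastLessThan]) (metis less linorder_neqE_nat)
    then have "Y w * (\<Sum>k\<in>{i..<J}. of_bool (?P k)) \<le> Y w"
      using Y(3)[OF w] by (simp add: mult_left_le)
    also have "Y w * (\<Sum>k\<in>{i..<J}. of_bool (?P k)) = (\<Sum>k\<in>{i..<J}. ?f k w)"
      unfolding sum_distrib_left by (rule sum.cong) (auto simp: indicator_def)
    finally show "(\<Sum>k\<in>{i..<J}. ?f k w) \<le> Y w" .
  qed (rule Y(2))
  finally show ?thesis .
qed

text \<open>
  The distance \<open>t - S k\<close> still to go is rounded down to a multiple \<open>m * d\<close>. Since \<open>h\<close> decreases in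
  this distance, rounding only increases the summand, and turns it into a product of a factor
  known at time \<open>k\<close> and a function of the next step. The expectation factorizes, and for
  each \<open>m\<close> the visits to the \<open>m\<close>-th slot are counted by \<open>renewal_bound\<close>.
\<close>

lemma potential_bound:
  fixes Y :: "'a \<Rightarrow> real" and h :: "real \<Rightarrow> real \<Rightarrow> real"
  assumes Y: "Y \<in> borel_measurable (past i)" "integrable M Y" "\<And>w. w \<in> space M \<Longrightarrow> 0 \<le> Y w"
    and h_meas [measurable]: "case_prod h \<in> borel_measurable (borel \<Otimes>\<^sub>M borel)"
    and h_bounds: "\<And>z x. x > 0 \<Longrightarrow> 0 \<le> h z x \<and> h z x \<le> 1"
    and h_antimono: "\<And>z z' x. x > 0 \<Longrightarrow> z \<le> z' \<Longrightarrow> h z' x \<le> h z x"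
    and d: "d > 0" and N: "t < real N * d"
  shows "prob {w \<in> space M. d \<le> \<xi> 1 w}
      * (\<Sum>k\<in>{i..<J}. expectation (\<lambda>w. Y w * (indicator {..t} (S k w) * h (t - S k w) (\<xi> (Suc k) w))))
    \<le> expectation Y * (\<Sum>m<N. expectation (\<lambda>w. h (real m * d) (\<xi> 1 w)))"
proof -
  define q where "q = prob {w \<in> space M. d \<le> \<xi> 1 w}"
  define A where "A m = {t - real (Suc m) * d<..t - real (Suc m) * d + d}" for m
  define p where "p k m = expectation (\<lambda>w. Y w * indicator (A m) (S k w))" for k m
  define H where "H m = expectation (\<lambda>w. h (real m * d) (\<xi> 1 w))" for m
  note [measurable] = borel_measurable_of_past[OF Y(1)]
  have [measurable]: "A m \<in> sets borel" for m by (simp add: A_def)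
  have [measurable]: "(\<lambda>x. h z x) \<in> borel_measurable borel" for z
  proof -
    have "(\<lambda>x. case_prod h (z, x)) \<in> borel_measurable borel" by measurable
    then show ?thesis by simp
  qed
  have h_comp: "(\<lambda>w. h (t - S k w) (\<xi> (Suc k) w)) \<in> borel_measurable M" for k
  proof -
    have "(\<lambda>w. case_prod h (t - S k w, \<xi> (Suc k) w)) \<in> borel_measurable M" by measurable
    then show ?thesis by simp
  qed
  note [measurable] = h_comp
  have hi: "integrable M (\<lambda>w. h z (\<xi> 1 w))" for z
    by (rule integrable_const_bound[of _ 1]) (use h_bounds step_pos[of _ 0] in auto)
  have H0: "H m \<ge> 0" for m
    unfolding H_def by (rule Bochner_Integration.integral_nonneg_AE) (use h_bounds step_pos[of _ 0] in auto)
  have split: "expectation (\<lambda>w. Y w * indicator (A m) (S k w) * h (real m * d) (\<xi> (Suc k) w)) = p k m * H m"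
    "integrable M (\<lambda>w. Y w * indicator (A m) (S k w) * h (real m * d) (\<xi> (Suc k) w))"
    if "k \<in> {i..<J}" for k m
    using expectation_past_step[OF past_times_indicator[OF Y(1,2), of k "A m"], of "h (real m * d)"] that hi
    by (auto simp: p_def H_def)
  have "expectation (\<lambda>w. Y w * (indicator {..t} (S k w) * h (t - S k w) (\<xi> (Suc k) w))) \<le> (\<Sum>m<N. p k m * H m)"
    if k: "k \<in> {i..<J}" for k
  proof -
    have "expectation (\<lambda>w. Y w * (indicator {..t} (S k w) * h (t - S k w) (\<xi> (Suc k) w)))
        \<le> expectation (\<lambda>w. \<Sum>m<N. Y w * indicator (A m) (S k w) * h (real m * d) (\<xi> (Suc k) w))"
    proof (rule integral_mono)
      show "integrable M (\<lambda>w. \<Sum>m<N. Y w * indicator (A m) (S k w) * h (real m * d) (\<xi> (Suc k) w))"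
        using split(2)[OF k] by (intro Bochner_Integration.integrable_sum)
      show "integrable M (\<lambda>w. Y w * (indicator {..t} (S k w) * h (t - S k w) (\<xi> (Suc k) w)))"
      proof (rule Bochner_Integration.integrable_bound[OF Y(2)])
        show "AE w in M. norm (Y w * (indicator {..t} (S k w) * h (t - S k w) (\<xi> (Suc k) w))) \<le> norm (Y w)"
          using h_bounds step_pos by (intro AE_I2) (auto simp: indicator_def abs_mult mult_left_le)
      qed measurable
      fix w assume w: "w \<in> space M"
      have x: "\<xi> (Suc k) w > 0" by (rule step_pos[OF w])
      have terms: "0 \<le> Y w * indicator (A m) (S k w) * h (real m * d) (\<xi> (Suc k) w)" for m
        using Y(3)[OF w] h_bounds[OF x] by simp
      show "Y w * (indicator {..t} (S k w) * h (t - S k w) (\<xi> (Suc k) w))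
          \<le> (\<Sum>m<N. Y w * indicator (A m) (S k w) * h (real m * d) (\<xi> (Suc k) w))"
      proof (cases "S k w \<le> t")
        case True
        define m where "m = nat \<lfloor>(t - S k w) / d\<rfloor>"
        have z: "0 \<le> (t - S k w) / d" using True d by simp
        have m: "real m \<le> (t - S k w) / d" "(t - S k w) / d < real m + 1"
          using z by (simp_all add: m_def)
        then have m': "real m * d \<le> t - S k w" "t - S k w < (real m + 1) * d"
          using d by (simp_all add: field_simps)
        have "real m * d < real N * d" using m'(1) N S_nonneg[OF w, of k] by linarith
        then have "m \<in> {..<N}" using d by simp
        moreover have "S k w \<in> A m" using m' by (auto simp: A_def algebra_simps)
        ultimately have "Y w * (indicator {..t} (S k w) * h (t - S k w) (\<xi> (Suc k) w))
            \<le> Y w * indicator (A m) (S k w) * h (real m * d) (\<xi> (Suc k) w)"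
          using True Y(3)[OF w] h_antimono[OF x m'(1)] by (simp add: mult_left_mono)
        also have "\<dots> \<le> (\<Sum>m<N. Y w * indicator (A m) (S k w) * h (real m * d) (\<xi> (Suc k) w))"
          by (rule member_le_sum) (use \<open>m \<in> {..<N}\<close> terms in auto)
        finally show ?thesis .
      next
        case False
        then show ?thesis using terms by (simp add: sum_nonneg)
      qed
    qed
    also have "\<dots> = (\<Sum>m<N. p k m * H m)"
      using split[OF k] by (subst Bochner_Integration.integral_sum) auto
    finally show ?thesis .
  qed
  then have "q * (\<Sum>k\<in>{i..<J}. expectation (\<lambda>w. Y w * (indicator {..t} (S k w) * h (t - S k w) (\<xi> (Suc k) w))))
      \<le> q * (\<Sum>k\<in>{i..<J}. \<Sum>m<N. p k m * H m)"
    by (intro mult_left_mono sum_mono) (auto simp: q_def)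
  also have "\<dots> = (\<Sum>m<N. q * (\<Sum>k\<in>{i..<J}. p k m) * H m)"
    by (subst sum.swap) (simp add: sum_distrib_left sum_distrib_right mult.assoc)
  also have "\<dots> \<le> (\<Sum>m<N. expectation Y * H m)"
  proof (intro sum_mono mult_right_mono H0)
    fix m
    show "q * (\<Sum>k\<in>{i..<J}. p k m) \<le> expectation Y"
      using renewal_bound[OF Y, of d "t - real (Suc m) * d" J] by (simp add: q_def p_def A_def)
  qed
  also have "\<dots> = expectation Y * (\<Sum>m<N. H m)" by (simp add: sum_distrib_left)
  finally show ?thesis by (simp add: q_def H_def)
qed

lemma ex_likely_step_size: "\<exists>d>0. prob {w \<in> space M. d \<le> \<xi> 1 w} > 0"
proof (rule ccontr)
  assume "\<not> ?thesis"
  then have null: "prob {w \<in> space M. 1 / real (Suc n) \<le> \<xi> 1 w} = 0" for n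
    by (metis measure_nonneg of_nat_0_less_iff order_le_less zero_less_Suc zero_less_divide_1_iff)
  have "AE w in M. \<not> 1 / real (Suc n) \<le> \<xi> 1 w" for n
    using null[of n] by (subst (asm) prob_eq_0) (auto elim!: AE_mp)
  then have "AE w in M. \<forall>n. \<not> 1 / real (Suc n) \<le> \<xi> 1 w" by (simp add: AE_all_countable)
  then have "AE w in M. False"
  proof (rule AE_mp, intro AE_I2 impI)
    fix w assume w: "w \<in> space M" and "\<forall>n. \<not> 1 / real (Suc n) \<le> \<xi> 1 w"
    moreover obtain n where "1 / real (Suc n) < \<xi> 1 w"
      using reals_Archimedean[of "\<xi> 1 w"] step_pos[OF w, of 0] by (auto simp: inverse_eq_divide)
    ultimately show False by (meson less_imp_le)
  qed
  then show False by simp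
qed

section \<open>First passage: Wald identities and overshoot\<close>

definition \<mu> :: real where "\<mu> = expectation (\<xi> 1)"

definition \<sigma>2 :: real where "\<sigma>2 = expectation (\<lambda>w. (\<xi> 1 w - \<mu>)\<^sup>2)"

text \<open>
  With \<open>\<tau>\<close> the number of \<open>k\<close> such that \<open>S k \<le> t\<close>, this is the minimum of \<open>\<tau>\<close> and \<open>J\<close>, because the walk
  increases; \<open>fluctuation\<close> below is the centred walk stopped at that time.
\<close>

definition passage :: "real \<Rightarrow> nat \<Rightarrow> 'a \<Rightarrow> real" where
  "passage t J w = (\<Sum>k<J. indicator {..t} (S k w))"

definition fluctuation :: "real \<Rightarrow> nat \<Rightarrow> 'a \<Rightarrow> real" where
  "fluctuation t J w = (\<Sum>k<J. indicator {..t} (S k w) * (\<xi> (Suc k) w - \<mu>))"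

definition tail_moment :: "real \<Rightarrow> real" where
  "tail_moment c = expectation (\<lambda>w. (\<xi> 1 w)\<^sup>2 * indicator {c<..} (\<xi> 1 w))"

lemma passage_measurable [measurable]: "passage t J \<in> borel_measurable M"
  unfolding passage_def by measurable

lemma fluctuation_measurable [measurable]: "fluctuation t J \<in> borel_measurable M"
  unfolding fluctuation_def by measurable

lemma integrable_step_1: "integrable M (\<xi> 1)"
  by (rule integrable_of_square_integrable[OF step_measurable_1 square_integrable])

lemma \<mu>_pos: "\<mu> > 0"
proof -
  have "AE w in M. 0 < \<xi> 1 w" using step_pos[of _ 0] by simp
  then have "expectation (\<lambda>_. 0) < expectation (\<xi> 1)"
    by (intro integral_less_AE_space) (auto simp: integrable_step_1[simplified] emeasure_space_1)
  then show ?thesis by (simp add: \<mu>_def)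
qed

lemma \<sigma>2_eq: "\<sigma>2 = expectation (\<lambda>w. (\<xi> 1 w)\<^sup>2) - \<mu>\<^sup>2"
  unfolding \<sigma>2_def \<mu>_def by (rule variance_eq[OF integrable_step_1 square_integrable])

lemma integrable_indicator_S [simp]: "integrable M (\<lambda>w. indicat_real {..t} (S k w))"
  by (rule integrable_const_bound[of _ 1]) (auto simp: indicator_def)

lemma expectation_passage: "expectation (passage t J) = (\<Sum>k<J. expectation (\<lambda>w. indicat_real {..t} (S k w)))"
  unfolding passage_def by (subst Bochner_Integration.integral_sum) auto

lemma passage_square_integrable: "integrable M (\<lambda>w. (passage t J w)\<^sup>2)"
proof (rule integrable_const_bound[of _ "(real J)\<^sup>2"])
  have "\<bar>passage t J w\<bar> \<le> real J" for w
  proof -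
    have "passage t J w \<le> (\<Sum>k<J. 1)" unfolding passage_def by (intro sum_mono) (auto simp: indicator_def)
    moreover have "passage t J w \<ge> 0" unfolding passage_def by (intro sum_nonneg) auto
    ultimately show ?thesis by simp
  qed
  then have "\<bar>passage t J w\<bar>\<^sup>2 \<le> (real J)\<^sup>2" for w by (intro power_mono) auto
  then show "AE w in M. norm ((passage t J w)\<^sup>2) \<le> (real J)\<^sup>2" by simp
qed measurable

text \<open>
  Both Wald identities: whether step \<open>k + 1\<close> counts is decided by the first \<open>k\<close> steps, so the centred
  step is orthogonal to everything before it.
\<close>

lemma fluctuation_moments:
  shows "integrable M (\<lambda>w. (fluctuation t J w)\<^sup>2)"
    and "expectation (fluctuation t J) = 0"
    and "expectation (\<lambda>w. (fluctuation t J w)\<^sup>2) = \<sigma>2 * expectation (passage t J)"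
proof -
  have "integrable M (\<lambda>w. (fluctuation t J w)\<^sup>2) \<and> expectation (fluctuation t J) = 0
    \<and> expectation (\<lambda>w. (fluctuation t J w)\<^sup>2) = \<sigma>2 * expectation (passage t J)"
  proof (induction J)
    case 0
    have "fluctuation t 0 = (\<lambda>_. 0)" "passage t 0 = (\<lambda>_. 0)"
      by (simp_all add: fluctuation_def passage_def fun_eq_iff)
    then show ?case by simp
  next
    case (Suc J)
    define F where "F = fluctuation t J"
    define T where "T w = indicat_real {..t} (S J w)" for w
    have [measurable]: "F \<in> borel_measurable M" "T \<in> borel_measurable M"
      unfolding F_def T_def by measurable
    have "(\<lambda>w. indicator {..t} (S k w) * (\<xi> (Suc k) w - \<mu>)) \<in> borel_measurable (past J)" if "k < J" for k
    proof -
      note [measurable] = step_measurable_past[OF that] S_measurable_past[OF less_imp_le[OF that]]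
      show ?thesis by measurable
    qed
    then have F_past: "F \<in> borel_measurable (past J)"
      unfolding F_def fluctuation_def by (intro borel_measurable_sum) auto
    have T_past: "T \<in> borel_measurable (past J)"
      unfolding T_def using S_measurable_past[of J J] by measurable
    have step2: "integrable M (\<lambda>w. (\<xi> 1 w - \<mu>)\<^sup>2)"
      using integrable_square_add[OF step_measurable_1, of "\<lambda>_. - \<mu>"] square_integrable by simp
    have step1: "integrable M (\<lambda>w. \<xi> 1 w - \<mu>)" using integrable_step_1 by simp
    have step0: "expectation (\<lambda>w. \<xi> 1 w - \<mu>) = 0" using integrable_step_1 by (simp add: \<mu>_def prob_space)
    have F2: "integrable M (\<lambda>w. (F w)\<^sup>2)" using Suc.IH by (simp add: F_def)
    have F1: "integrable M F" by (rule integrable_of_square_integrable[OF _ F2]) measurable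
    have T1: "integrable M T" unfolding T_def by simp
    have FT: "integrable M (\<lambda>w. F w * T w)"
      by (rule Bochner_Integration.integrable_bound[OF F1]) (auto simp: T_def indicator_def)
    have FT_past: "(\<lambda>w. F w * T w) \<in> borel_measurable (past J)" using F_past T_past by measurable
    note new = expectation_past_step[OF T_past T1, of "\<lambda>x. x - \<mu>"]
      expectation_past_step[OF T_past T1, of "\<lambda>x. (x - \<mu>)\<^sup>2"]
      expectation_past_step[OF FT_past FT, of "\<lambda>x. x - \<mu>"]
    have D: "fluctuation t (Suc J) = (\<lambda>w. F w + T w * (\<xi> (Suc J) w - \<mu>))"
      by (simp add: F_def T_def fluctuation_def fun_eq_iff)
    have TT: "T w * T w = T w" for w by (simp add: T_def indicator_def)
    have D2: "(\<lambda>w. (fluctuation t (Suc J) w)\<^sup>2)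
        = (\<lambda>w. (F w)\<^sup>2 + 2 * (F w * T w * (\<xi> (Suc J) w - \<mu>)) + T w * (\<xi> (Suc J) w - \<mu>)\<^sup>2)"
    proof
      fix w
      have "(fluctuation t (Suc J) w)\<^sup>2
        = (F w)\<^sup>2 + 2 * (F w * T w * (\<xi> (Suc J) w - \<mu>)) + (T w * T w) * (\<xi> (Suc J) w - \<mu>)\<^sup>2"
        unfolding D by (simp add: power2_eq_square algebra_simps)
      then show "(fluctuation t (Suc J) w)\<^sup>2
        = (F w)\<^sup>2 + 2 * (F w * T w * (\<xi> (Suc J) w - \<mu>)) + T w * (\<xi> (Suc J) w - \<mu>)\<^sup>2"
        unfolding TT .
    qed
    have a: "integrable M (\<lambda>w. (fluctuation t (Suc J) w)\<^sup>2)"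
      unfolding D2 using F2 new step1 step2 by simp
    have b: "expectation (fluctuation t (Suc J)) = 0"
      unfolding D using F1 new(1,2) step1 step0 Suc.IH by (simp add: F_def)
    have "expectation (\<lambda>w. (fluctuation t (Suc J) w)\<^sup>2)
        = \<sigma>2 * expectation (passage t J) + expectation T * \<sigma>2"
      unfolding D2 using F2 new step1 step0 step2 Suc.IH by (simp add: F_def \<sigma>2_def)
    also have "\<dots> = \<sigma>2 * expectation (passage t (Suc J))"
      by (simp add: expectation_passage T_def[abs_def] algebra_simps)
    finally show ?case using a b by simp
  qed
  then show "integrable M (\<lambda>w. (fluctuation t J w)\<^sup>2)" "expectation (fluctuation t J) = 0"
    "expectation (\<lambda>w. (fluctuation t J w)\<^sup>2) = \<sigma>2 * expectation (passage t J)" by auto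
qed

lemma passage_bounds:
  obtains C where "C > 0" "\<And>t J. 0 \<le> t \<Longrightarrow> expectation (passage t J) \<le> C * (t + 1)"
proof -
  obtain d where d: "d > 0" "prob {w \<in> space M. d \<le> \<xi> 1 w} > 0" using ex_likely_step_size by auto
  define q where "q = prob {w \<in> space M. d \<le> \<xi> 1 w}"
  have q: "q > 0" using d by (simp add: q_def)
  define C where "C = (1 / d + 1) / q"
  have "C > 0" using d q by (simp add: C_def add_pos_pos)
  moreover have "expectation (passage t J) \<le> C * (t + 1)" if "0 \<le> t" for t J
  proof -
    define N where "N = nat \<lfloor>t / d\<rfloor> + 1"
    have "real N = real_of_int \<lfloor>t / d\<rfloor> + 1" using that d by (simp add: N_def)
    then have N: "real N \<le> t / d + 1" "t / d < real N" by linarith+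
    have "q * (\<Sum>k\<in>{0..<J}. expectation (\<lambda>w. 1 * (indicat_real {..t} (S k w) * 1)))
        \<le> expectation (\<lambda>_. 1) * (\<Sum>m<N. expectation (\<lambda>w. 1))"
      unfolding q_def by (rule potential_bound[where h="\<lambda>_ _. 1" and d=d])
        (use N d in \<open>auto simp: field_simps\<close>)
    then have "q * expectation (passage t J) \<le> real N"
      by (simp add: expectation_passage prob_space lessThan_atLeast0)
    then have "expectation (passage t J) \<le> real N / q" using q by (simp add: field_simps)
    also have "\<dots> \<le> (t / d + 1) / q" using N q by (simp add: divide_right_mono)
    also have "\<dots> \<le> C * (t + 1)"
      using that d q by (simp add: C_def field_simps)
    finally show ?thesis .
  qed
  ultimately show ?thesis using that by blast
qed

lemma S_tends_to_infinity:
  assumes "0 \<le> t"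
  shows "(\<lambda>J. expectation (\<lambda>w. indicat_real {..t} (S J w))) \<longlonglongrightarrow> 0"
proof -
  obtain C where C: "C > 0" "\<And>t J. 0 \<le> t \<Longrightarrow> expectation (passage t J) \<le> C * (t + 1)"
    using passage_bounds by blast
  have "summable (\<lambda>J. expectation (\<lambda>w. indicat_real {..t} (S J w)))"
  proof (rule summableI_nonneg_bounded)
    show "(\<Sum>k<J. expectation (\<lambda>w. indicat_real {..t} (S k w))) \<le> C * (t + 1)" for J
      using C(2)[OF assms, of J] by (simp add: expectation_passage)
  qed simp
  then show ?thesis by (rule summable_LIMSEQ_zero)
qed

lemma tail_moment_tendsto_0: "(tail_moment \<longlongrightarrow> 0) at_top"
proof -
  have "((\<lambda>c. expectation (\<lambda>w. (\<xi> 1 w)\<^sup>2 * indicator {c<..} (\<xi> 1 w))) \<longlongrightarrow> expectation (\<lambda>w. 0)) at_top"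
  proof (rule integral_dominated_convergence_at_top[where w="\<lambda>w. (\<xi> 1 w)\<^sup>2"])
    show "AE w in M. ((\<lambda>c. (\<xi> 1 w)\<^sup>2 * indicator {c<..} (\<xi> 1 w)) \<longlongrightarrow> 0) at_top"
    proof (intro AE_I2 tendsto_eventually)
      fix w
      show "\<forall>\<^sub>F c in at_top. (\<xi> 1 w)\<^sup>2 * indicator {c<..} (\<xi> 1 w) = 0"
        using eventually_ge_at_top[of "\<xi> 1 w"] by eventually_elim simp
    qed
  qed (use square_integrable in \<open>auto simp: indicator_def\<close>)
  then show ?thesis by (simp add: tail_moment_def[abs_def])
qed

text \<open>
  Here \<open>\<mu> * passage + fluctuation\<close> is the position of the walk when it is stopped. If it has passed \<open>t\<close>,
  its distance from \<open>t\<close> is at most the size of the passing step, which is either at most \<open>c\<close> or one of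
  the large steps collected in the sum. If it has not, its distance from \<open>t\<close> is at most \<open>t\<close>.
\<close>

lemma overshoot_pointwise:
  assumes w: "w \<in> space M" and "0 \<le> t" "0 \<le> c"
  shows "(\<mu> * passage t J w + fluctuation t J w - t)\<^sup>2 \<le> t\<^sup>2 * indicator {..t} (S J w) + c\<^sup>2
    + (\<Sum>k<J. indicator {..t} (S k w) * ((\<xi> (Suc k) w)\<^sup>2 * indicator {c<..} (\<xi> (Suc k) w)))"
    (is "?lhs \<le> _ + _ + ?R")
proof -
  have Q: "\<mu> * passage t J w + fluctuation t J w = (\<Sum>k<J. indicator {..t} (S k w) * \<xi> (Suc k) w)"
    unfolding passage_def fluctuation_def sum_distrib_left sum.distrib[symmetric]
    by (rule sum.cong) (auto simp: algebra_simps)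
  have R0: "?R \<ge> 0" by (intro sum_nonneg) auto
  show ?thesis
  proof (cases "S J w \<le> t")
    case True
    have "(\<Sum>k<J. indicator {..t} (S k w) * \<xi> (Suc k) w) = S J w"
      unfolding S_def
    proof (rule sum.cong)
      fix k assume "k \<in> {..<J}"
      then have "S k w \<le> t" using S_mono[OF w, of k J] True by simp
      then show "indicator {..t} (\<Sum>i<k. \<xi> (Suc i) w) * \<xi> (Suc k) w = \<xi> (Suc k) w" by (simp add: S_def)
    qed simp
    then have "?lhs = (t - S J w)\<^sup>2" by (simp add: Q power2_commute)
    also have "\<dots> \<le> t\<^sup>2" using True S_nonneg[OF w, of J] by (intro power_mono) auto
    finally have "?lhs \<le> t\<^sup>2 * indicator {..t} (S J w)" using True by simp
    with R0 zero_le_power2[of c] show ?thesis by linarith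
  next
    case False
    define k0 where "k0 = (LEAST k. S k w > t)"
    have k0: "S k0 w > t" "k0 \<le> J"
      unfolding k0_def using False LeastI[of "\<lambda>k. t < S k w" J] Least_le[of "\<lambda>k. t < S k w" J] by auto
    have "k0 \<noteq> 0" using k0(1) \<open>0 \<le> t\<close> by (intro notI) simp
    then obtain k1 where k1: "k0 = Suc k1" by (cases k0) auto
    have T: "S k w \<le> t \<longleftrightarrow> k \<le> k1" for k
    proof
      assume "S k w \<le> t"
      then show "k \<le> k1" using k0 S_mono[OF w, of k0 k] k1 by (cases "k \<le> k1") auto
    next
      assume "k \<le> k1"
      then have "\<not> S k w > t" using not_less_Least[of k "\<lambda>k. S k w > t"] k1 by (simp add: k0_def)
      then show "S k w \<le> t" by simp
    qed
    have "(\<Sum>k<J. indicator {..t} (S k w) * \<xi> (Suc k) w) = (\<Sum>k<k0. \<xi> (Suc k) w)"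
      by (rule sum.mono_neutral_cong_right) (use k0 k1 T in auto)
    then have Q': "?lhs = (S k0 w - t)\<^sup>2" by (simp add: Q S_def)
    have S: "0 \<le> S k0 w - t" "S k0 w - t \<le> \<xi> (Suc k1) w"
      using k0 T[of k1] k1 by (auto simp: S_Suc)
    show ?thesis
    proof (cases "\<xi> (Suc k1) w \<le> c")
      case True
      then have "(S k0 w - t)\<^sup>2 \<le> c\<^sup>2" using S by (intro power_mono) auto
      then show ?thesis using Q' R0 by (simp add: add_increasing add_increasing2)
    next
      case False
      have "(S k0 w - t)\<^sup>2 \<le> (\<xi> (Suc k1) w)\<^sup>2" using S by (intro power_mono) auto
      also have "\<dots> = indicator {..t} (S k1 w) * ((\<xi> (Suc k1) w)\<^sup>2 * indicator {c<..} (\<xi> (Suc k1) w))"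
        using False T[of k1] by simp
      also have "\<dots> \<le> ?R" by (rule member_le_sum) (use k0 k1 in auto)
      finally show ?thesis using Q' by (simp add: add_increasing add_increasing2)
    qed
  qed
qed

lemma overshoot_square_integrable:
  "integrable M (\<lambda>w. (\<mu> * passage t J w + fluctuation t J w - t)\<^sup>2)"
proof -
  have "integrable M (\<lambda>w. (\<mu> * passage t J w)\<^sup>2)"
    using passage_square_integrable by (simp add: power_mult_distrib)
  then have "integrable M (\<lambda>w. (\<mu> * passage t J w + fluctuation t J w)\<^sup>2)"
    using fluctuation_moments(1) by (intro integrable_square_add) auto
  from integrable_square_add[OF _ _ this, of "\<lambda>_. - t"] show ?thesis by simp
qed

lemma overshoot_bound:
  assumes "0 \<le> t" "0 \<le> c"
  shows "expectation (\<lambda>w. (\<mu> * passage t J w + fluctuation t J w - t)\<^sup>2)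
    \<le> t\<^sup>2 * expectation (\<lambda>w. indicat_real {..t} (S J w)) + c\<^sup>2 + tail_moment c * expectation (passage t J)"
proof -
  define f where "f k w = indicator {..t} (S k w) * ((\<xi> (Suc k) w)\<^sup>2 * indicator {c<..} (\<xi> (Suc k) w))"
    for k w
  have "integrable M (\<lambda>w. (\<xi> 1 w)\<^sup>2 * indicator {c<..} (\<xi> 1 w))"
    by (rule Bochner_Integration.integrable_bound[OF square_integrable]) (auto simp: indicator_def)
  then have f: "expectation (f k) = expectation (\<lambda>w. indicat_real {..t} (S k w)) * tail_moment c" "integrable M (f k)" for k
    using expectation_past_step[of "\<lambda>w. indicat_real {..t} (S k w)" k "\<lambda>x. x\<^sup>2 * indicator {c<..} x"]
      S_measurable_past[of k k]
    by (auto simp: f_def[abs_def] tail_moment_def)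
  have "expectation (\<lambda>w. (\<mu> * passage t J w + fluctuation t J w - t)\<^sup>2)
    \<le> expectation (\<lambda>w. t\<^sup>2 * indicator {..t} (S J w) + c\<^sup>2 + (\<Sum>k<J. f k w))"
  proof (rule integral_mono)
    show "integrable M (\<lambda>w. (\<mu> * passage t J w + fluctuation t J w - t)\<^sup>2)"
      by (rule overshoot_square_integrable)
    show "integrable M (\<lambda>w. t\<^sup>2 * indicator {..t} (S J w) + c\<^sup>2 + (\<Sum>k<J. f k w))"
      using f(2) by simp
    fix w assume "w \<in> space M"
    then show "(\<mu> * passage t J w + fluctuation t J w - t)\<^sup>2 \<le> t\<^sup>2 * indicator {..t} (S J w) + c\<^sup>2 + (\<Sum>k<J. f k w)"
      using overshoot_pointwise[of w t c J] assms by (simp add: f_def)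
  qed
  also have "\<dots> = t\<^sup>2 * expectation (\<lambda>w. indicat_real {..t} (S J w)) + c\<^sup>2 + (\<Sum>k<J. expectation (f k))"
    using f(2) by (simp add: prob_space)
  also have "(\<Sum>k<J. expectation (f k)) = tail_moment c * expectation (passage t J)"
    by (simp add: f(1) expectation_passage sum_distrib_left mult.commute)
  finally show ?thesis .
qed

text \<open>
  For a fixed level \<open>c\<close> the bound on the overshoot is a constant plus \<open>tail_moment c\<close> times \<open>O(t)\<close>.
  Letting first \<open>t\<close> and then \<open>c\<close> tend to infinity shows that it is \<open>o(t)\<close>; the mean of the passage
  count follows, because the fluctuation is centred.
\<close>

lemma passage_asymptotics:
  fixes t :: "nat \<Rightarrow> real" and J :: "nat \<Rightarrow> nat"
  assumes t: "filterlim t at_top sequentially"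
    and J: "\<And>n. (t n)\<^sup>2 * expectation (\<lambda>w. indicat_real {..t n} (S (J n) w)) \<le> 1"
  shows "(\<lambda>n. expectation (\<lambda>w. (\<mu> * passage (t n) (J n) w + fluctuation (t n) (J n) w - t n)\<^sup>2) / t n)
      \<longlonglongrightarrow> 0" (is "(\<lambda>n. ?E n / t n) \<longlonglongrightarrow> 0")
    and "(\<lambda>n. expectation (passage (t n) (J n)) / t n) \<longlonglongrightarrow> 1 / \<mu>"
proof -
  obtain C where C: "C > 0" "\<And>t J. 0 \<le> t \<Longrightarrow> expectation (passage t J) \<le> C * (t + 1)"
    using passage_bounds by blast
  have E0: "?E n \<ge> 0" for n by simp
  have t1: "\<forall>\<^sub>F n in sequentially. t n \<ge> 1" using t by (simp add: filterlim_at_top)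
  show E_lim: "(\<lambda>n. ?E n / t n) \<longlonglongrightarrow> 0"
  proof (rule tendstoI)
    fix \<epsilon> :: real assume "\<epsilon> > 0"
    define \<delta> where "\<delta> = \<epsilon> / (2 * C)"
    have "\<delta> > 0" using \<open>\<epsilon> > 0\<close> C by (simp add: \<delta>_def)
    have "\<forall>\<^sub>F c in at_top. tail_moment c < \<delta> \<and> c \<ge> 0"
      using order_tendstoD(2)[OF tail_moment_tendsto_0 \<open>\<delta> > 0\<close>] eventually_ge_at_top[of 0]
      by eventually_elim simp
    then obtain c where c: "tail_moment c < \<delta>" "c \<ge> 0" by (auto simp: eventually_at_top_linorder)
    have "\<forall>\<^sub>F n in sequentially. t n > (1 + c\<^sup>2 + \<delta> * C) / (\<epsilon> / 2)"
      using t by (simp add: filterlim_at_top_dense)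
    with t1 show "\<forall>\<^sub>F n in sequentially. dist (?E n / t n) 0 < \<epsilon>"
    proof eventually_elim
      case (elim n)
      have p0: "0 \<le> expectation (passage (t n) (J n))"
        by (rule Bochner_Integration.integral_nonneg_AE) (auto simp: passage_def sum_nonneg)
      have "?E n \<le> 1 + c\<^sup>2 + tail_moment c * expectation (passage (t n) (J n))"
        using overshoot_bound[of "t n" c "J n"] J[of n] elim c by simp
      also have "\<dots> \<le> 1 + c\<^sup>2 + \<delta> * (C * (t n + 1))"
        using c C(2)[of "t n" "J n"] elim p0 \<open>\<delta> > 0\<close> by (intro add_mono mult_mono) auto
      also have "\<dots> = (1 + c\<^sup>2 + \<delta> * C) + (\<epsilon> / 2) * t n" using C(1) by (simp add: \<delta>_def field_simps)
      also have "\<dots> < (\<epsilon> / 2) * t n + (\<epsilon> / 2) * t n"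
        using elim \<open>\<epsilon> > 0\<close> by (simp add: field_simps)
      finally have "?E n < \<epsilon> * t n" by simp
      then show ?case using elim E0[of n] by (simp add: field_simps)
    qed
  qed
  have "(\<lambda>n. \<mu> * (expectation (passage (t n) (J n)) / t n) - 1) \<longlonglongrightarrow> 0"
  proof (rule Lim_null_comparison)
    have "(\<lambda>n. sqrt (?E n / t n)) \<longlonglongrightarrow> sqrt 0" by (intro tendsto_intros E_lim)
    then show "(\<lambda>n. sqrt (?E n / t n)) \<longlonglongrightarrow> 0" by simp
    show "\<forall>\<^sub>F n in sequentially. norm (\<mu> * (expectation (passage (t n) (J n)) / t n) - 1) \<le> sqrt (?E n / t n)"
      using t1
    proof eventually_elim
      case (elim n)
      let ?P = "passage (t n) (J n)" and ?F = "fluctuation (t n) (J n)"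
      let ?D = "\<lambda>w. \<mu> * ?P w + ?F w - t n"
      have i: "integrable M ?P" "integrable M ?F"
        by (rule integrable_of_square_integrable, measurable, rule passage_square_integrable fluctuation_moments)+
      have D2: "integrable M (\<lambda>w. (?D w)\<^sup>2)" by (rule overshoot_square_integrable)
      have "expectation ?D = \<mu> * expectation ?P - t n"
        using i fluctuation_moments(2)[of "t n" "J n"] by (simp add: prob_space)
      moreover have "\<bar>expectation (\<lambda>w. ?D w * 1)\<bar> \<le> sqrt (?E n) * sqrt (expectation (\<lambda>w. 1\<^sup>2))"
        by (rule Cauchy_Schwarz_expectation) (use D2 in auto)
      ultimately have "\<bar>\<mu> * expectation ?P - t n\<bar> \<le> sqrt (?E n)" by (simp add: prob_space)
      then have "\<bar>\<mu> * expectation ?P - t n\<bar> / t n \<le> sqrt (?E n) / t n"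
        using elim by (intro divide_right_mono) auto
      also have "\<dots> \<le> sqrt (?E n) / sqrt (t n)"
        using elim by (intro divide_left_mono) (auto simp: real_le_lsqrt self_le_power power2_eq_square)
      also have "\<dots> = sqrt (?E n / t n)" by (simp add: real_sqrt_divide)
      also have "\<bar>\<mu> * expectation ?P - t n\<bar> / t n = \<bar>\<mu> * (expectation ?P / t n) - 1\<bar>"
      proof -
        have "\<mu> * (expectation ?P / t n) - 1 = (\<mu> * expectation ?P - t n) / t n"
          using elim by (simp add: diff_divide_distrib)
        then show ?thesis using elim by simp
      qed
      finally show ?case by simp
    qed
  qed
  from tendsto_divide[OF tendsto_add[OF this tendsto_const[of 1]] tendsto_const[of \<mu>]]
  show "(\<lambda>n. expectation (passage (t n) (J n)) / t n) \<longlonglongrightarrow> 1 / \<mu>"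
    using \<mu>_pos by simp
qed

end

section \<open>Doubly exponential potentials of the walk\<close>

text \<open>
  The right-hand side telescopes along \<open>z = 0, d, 2 * d, \<dots>\<close>, which sums the double exponential without
  distinguishing whether \<open>exp z\<close> is smaller or larger than \<open>1 / x\<close>. With \<open>y = exp z * x\<close> it rests on
  \<open>exp (- y) \<le> 1 / (1 + y)\<close> and \<open>ln r \<ge> 1 - 1 / r\<close>.
\<close>

lemma exp_neg_le_ln_diff:
  fixes z x d :: real
  assumes "x > 0" "d > 0"
  shows "exp (- (exp z * x)) \<le> (ln (1 + exp (- z) / x) - ln (1 + exp (- (z + d)) / x)) / (1 - exp (- d))"
proof -
  define y where "y = exp z * x"
  define r where "r = (y + 1) / (y + exp (- d))"
  have y: "y > 0" using assms by (simp add: y_def)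
  have d: "0 < 1 - exp (- d)" using assms by simp
  have r0: "r > 0" using y by (simp add: r_def add_pos_pos)
  have "exp (- z) / x = 1 / y" "exp (- (z + d)) / x = exp (- d) / y"
    using assms by (simp_all add: y_def exp_minus exp_diff field_simps)
  moreover have "0 < 1 + 1 / y" "0 < 1 + exp (- d) / y" using y by (auto intro: add_pos_pos)
  then have "1 + 1 / y \<noteq> 0" "1 + exp (- d) / y \<noteq> 0" by linarith+
  ultimately have "ln (1 + exp (- z) / x) - ln (1 + exp (- (z + d)) / x) = ln ((1 + 1 / y) / (1 + exp (- d) / y))"
    by (simp add: ln_div)
  also have "(1 + 1 / y) / (1 + exp (- d) / y) = ((y + 1) / y) / ((y + exp (- d)) / y)"
    using y by (simp add: add_divide_distrib)
  also have "\<dots> = r" using y by (simp add: r_def)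
  finally have L: "ln (1 + exp (- z) / x) - ln (1 + exp (- (z + d)) / x) = ln r" .
  have "ln (1 / r) \<le> 1 / r - 1" by (rule ln_le_minus_one) (use r0 in simp)
  then have "1 - 1 / r \<le> ln r" using r0 by (simp add: ln_div)
  moreover have "1 - 1 / r = (1 - exp (- d)) / (1 + y)"
    using y add_pos_pos[OF y exp_gt_zero[of "- d"]] by (simp add: r_def field_simps)
  ultimately have "(1 - exp (- d)) / (1 + y) \<le> ln r" by simp
  then have "1 / (1 + y) \<le> ln r / (1 - exp (- d))" using d y by (simp add: field_simps)
  moreover have "exp (- y) \<le> 1 / (1 + y)"
    using exp_ge_add_one_self[of y] y by (simp add: exp_minus field_simps)
  ultimately show ?thesis unfolding L y_def by linarith
qed

lemma sum_exp_neg_le_ln: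
  fixes x d :: real
  assumes "x > 0" "d > 0"
  shows "(\<Sum>m<N. exp (- (exp (real m * d) * x))) \<le> ln (1 + 1 / x) / (1 - exp (- d))"
proof -
  define f where "f m = ln (1 + exp (- (real m * d)) / x)" for m
  have d: "0 < 1 - exp (- d)" using assms by simp
  have "f (Suc m) = ln (1 + exp (- (real m * d + d)) / x)" for m
    by (simp add: f_def algebra_simps)
  then have "(\<Sum>m<N. exp (- (exp (real m * d) * x))) \<le> (\<Sum>m<N. (f m - f (Suc m)) / (1 - exp (- d)))"
    using exp_neg_le_ln_diff[OF assms] by (intro sum_mono) (simp only: f_def)
  also have "\<dots> = (f 0 - f N) / (1 - exp (- d))"
    by (simp add: sum_divide_distrib[symmetric] sum_lessThan_telescope')
  also have "\<dots> \<le> f 0 / (1 - exp (- d))"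
    using assms d by (intro divide_right_mono) (auto simp: f_def)
  finally show ?thesis by (simp add: f_def)
qed

context positive_walk
begin

text \<open>
  The interval between \<open>1 - exp (- S k)\<close> and \<open>1 - exp (- S (Suc k))\<close> has length
  \<open>p = exp (- S k) * (1 - exp (- \<xi> (Suc k)))\<close>. For \<open>t = ln n\<close> the exponential below is \<open>exp (- n * p)\<close>,
  an upper bound for the probability that \<open>n\<close> uniform points all miss it.
\<close>

definition gap_damping :: "real \<Rightarrow> nat \<Rightarrow> 'a \<Rightarrow> real" where
  "gap_damping t k w = indicator {..t} (S k w) * exp (- (exp (t - S k w) * (1 - exp (- \<xi> (Suc k) w))))"

lemma gap_damping_measurable [measurable]: "gap_damping t k \<in> borel_measurable M"
  unfolding gap_damping_def by measurable

lemma gap_damping_measurable_past: "gap_damping t k \<in> borel_measurable (past (Suc k))"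
proof -
  note [measurable] = step_measurable_past[of k "Suc k", simplified] S_measurable_past[of k "Suc k", simplified]
  show ?thesis unfolding gap_damping_def by measurable
qed

lemma gap_damping_bounds: "w \<in> space M \<Longrightarrow> 0 \<le> gap_damping t k w \<and> gap_damping t k w \<le> 1"
  using step_pos[of w k] by (auto simp: gap_damping_def indicator_def)

lemma integrable_gap_damping: "integrable M (gap_damping t k)"
  by (rule integrable_const_bound[of _ 1]) (use gap_damping_bounds in auto)

text \<open>
  The constant \<open>b\<close> depends neither on the level \<open>t\<close> nor on the weight \<open>Y\<close>. Uniformity in \<open>t\<close> holds since
  the sum of the double exponentials over all slots is at most a constant times
  \<open>ln 2 + \<bar>ln (1 - exp (- \<xi> 1))\<bar>\<close>.
\<close>

lemma gap_potential_bound: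
  assumes log: "integrable M (\<lambda>w. ln (1 - exp (- \<xi> 1 w)))"
  obtains b where "b \<ge> 0"
    "\<And>Y i t J. \<lbrakk>Y \<in> borel_measurable (past i); integrable M Y; \<And>w. w \<in> space M \<Longrightarrow> 0 \<le> Y w\<rbrakk>
      \<Longrightarrow> (\<Sum>k\<in>{i..<J}. expectation (\<lambda>w. Y w * gap_damping t k w)) \<le> b * expectation Y"
proof -
  obtain d where d: "d > 0" "prob {w \<in> space M. d \<le> \<xi> 1 w} > 0" using ex_likely_step_size by auto
  define q where "q = prob {w \<in> space M. d \<le> \<xi> 1 w}"
  have q: "q > 0" using d by (simp add: q_def)
  define L where "L = expectation (\<lambda>w. ln 2 + \<bar>ln (1 - exp (- \<xi> 1 w))\<bar>)"
  define c where "c = 1 - exp (- d)"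
  have c: "c > 0" using d by (simp add: c_def)
  define h where "h z x = exp (- (exp z * (1 - exp (- x))))" for z x :: real
  have Li: "integrable M (\<lambda>w. ln 2 + \<bar>ln (1 - exp (- \<xi> 1 w))\<bar>)" using log by simp
  have L0: "L \<ge> 0" unfolding L_def by (rule Bochner_Integration.integral_nonneg_AE) simp
  have h_meas [measurable]: "case_prod h \<in> borel_measurable (borel \<Otimes>\<^sub>M borel)"
    unfolding h_def case_prod_beta' by measurable
  have h01: "0 \<le> h z x" "x > 0 \<Longrightarrow> h z x \<le> 1" for z x by (auto simp: h_def)
  have "(\<lambda>w. h z (\<xi> 1 w)) \<in> borel_measurable M" for z unfolding h_def by measurable
  then have hi: "integrable M (\<lambda>w. h z (\<xi> 1 w))" for z
    by (intro integrable_const_bound[of _ 1]) (use h01 step_pos[of _ 0] in auto)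
  have sum_h: "(\<Sum>m<N. expectation (\<lambda>w. h (real m * d) (\<xi> 1 w))) \<le> L / c" for N
  proof -
    have "(\<Sum>m<N. expectation (\<lambda>w. h (real m * d) (\<xi> 1 w))) = expectation (\<lambda>w. \<Sum>m<N. h (real m * d) (\<xi> 1 w))"
      using hi by (subst Bochner_Integration.integral_sum) auto
    also have "\<dots> \<le> expectation (\<lambda>w. (ln 2 + \<bar>ln (1 - exp (- \<xi> 1 w))\<bar>) / c)"
    proof (rule integral_mono)
      fix w assume w: "w \<in> space M"
      define x where "x = 1 - exp (- \<xi> 1 w)"
      have x: "0 < x" "x < 1" using step_pos[OF w, of 0] by (auto simp: x_def)
      have "(\<Sum>m<N. h (real m * d) (\<xi> 1 w)) \<le> ln (1 + 1 / x) / c"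
        using sum_exp_neg_le_ln[OF x(1) d(1), of N] by (simp add: h_def x_def c_def)
      also have "ln (1 + 1 / x) \<le> ln (2 / x)"
        using x by (subst ln_le_cancel_iff) (auto simp: field_simps)
      also have "\<dots> \<le> ln 2 + \<bar>ln x\<bar>" using x by (simp add: ln_div)
      finally show "(\<Sum>m<N. h (real m * d) (\<xi> 1 w)) \<le> (ln 2 + \<bar>ln (1 - exp (- \<xi> 1 w))\<bar>) / c"
        using c by (simp add: x_def divide_right_mono)
    qed (use hi Li in auto)
    also have "\<dots> = L / c" by (simp add: L_def)
    finally show ?thesis .
  qed
  show ?thesis
  proof (rule that[of "L / c / q"])
    show "0 \<le> L / c / q" using L0 c q by simp
    fix Y :: "'a \<Rightarrow> real" and i t J
    assume Y: "Y \<in> borel_measurable (past i)" "integrable M Y" "\<And>w. w \<in> space M \<Longrightarrow> 0 \<le> Y w"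
    obtain N :: nat where "t / d < real N" using reals_Archimedean2 by blast
    then have N: "t < real N * d" using d by (simp add: field_simps)
    have "q * (\<Sum>k\<in>{i..<J}. expectation (\<lambda>w. Y w * gap_damping t k w))
        \<le> expectation Y * (\<Sum>m<N. expectation (\<lambda>w. h (real m * d) (\<xi> 1 w)))"
      unfolding q_def gap_damping_def
      using potential_bound[OF Y h_meas _ _ d(1) N, of J] h01 by (auto simp: h_def)
    also have "\<dots> \<le> expectation Y * (L / c)"
      by (intro mult_left_mono sum_h Bochner_Integration.integral_nonneg_AE) (use Y(3) in auto)
    finally have "(\<Sum>k\<in>{i..<J}. expectation (\<lambda>w. Y w * gap_damping t k w)) \<le> expectation Y * (L / c) / q"
      by (subst pos_le_divide_eq[OF q]) (simp only: mult.commute)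
    then show "(\<Sum>k\<in>{i..<J}. expectation (\<lambda>w. Y w * gap_damping t k w)) \<le> L / c / q * expectation Y"
      by (simp add: mult_ac)
  qed
qed

end

section \<open>Empty and occupied cells\<close>

text \<open>
  Fubini on the sample space itself: independent variables may be evaluated at two unrelated sample
  points, which replaces conditioning on \<open>X\<close> by fixing the first sample point.
\<close>

lemma (in prob_space) nn_integral_indep_pair:
  assumes ind: "indep_var S X T Y" and F [measurable]: "F \<in> borel_measurable (S \<Otimes>\<^sub>M T)"
  shows "(\<integral>\<^sup>+w. F (X w, Y w) \<partial>M) = (\<integral>\<^sup>+w. \<integral>\<^sup>+w'. F (X w, Y w') \<partial>M \<partial>M)"
proof -
  have [measurable]: "X \<in> M \<rightarrow>\<^sub>M S" "Y \<in> M \<rightarrow>\<^sub>M T"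
    using ind indep_var_rv1 indep_var_rv2 by blast+
  interpret Y: prob_space "distr M T Y" by (rule prob_space_distr) measurable
  have "(\<integral>\<^sup>+w. F (X w, Y w) \<partial>M) = (\<integral>\<^sup>+z. F z \<partial>distr M (S \<Otimes>\<^sub>M T) (\<lambda>w. (X w, Y w)))"
    by (subst nn_integral_distr) auto
  also have "\<dots> = (\<integral>\<^sup>+z. F z \<partial>(distr M S X \<Otimes>\<^sub>M distr M T Y))"
    using ind by (simp add: indep_var_distribution_eq)
  also have "\<dots> = (\<integral>\<^sup>+x. \<integral>\<^sup>+y. F (x, y) \<partial>distr M T Y \<partial>distr M S X)"
    by (rule Y.nn_integral_fst[symmetric]) simp
  also have "\<dots> = (\<integral>\<^sup>+w. \<integral>\<^sup>+y. F (X w, y) \<partial>distr M T Y \<partial>M)"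
    by (subst nn_integral_distr) auto
  also have "\<dots> = (\<integral>\<^sup>+w. \<integral>\<^sup>+w'. F (X w, Y w') \<partial>M \<partial>M)"
  proof (rule nn_integral_cong)
    fix w assume "w \<in> space M"
    then have [measurable]: "X w \<in> space S" by (rule measurable_space[rotated]) measurable
    show "(\<integral>\<^sup>+y. F (X w, y) \<partial>distr M T Y) = (\<integral>\<^sup>+w'. F (X w, Y w') \<partial>M)"
      by (subst nn_integral_distr) auto
  qed
  finally show ?thesis .
qed

lemma sum_square_pairs:
  fixes a :: "nat \<Rightarrow> real"
  shows "(\<Sum>k<J. a k)\<^sup>2 = (\<Sum>k<J. (a k)\<^sup>2) + 2 * (\<Sum>i<J. \<Sum>k\<in>{Suc i..<J}. a i * a k)"
proof (induction J)
  case (Suc J)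
  have "(\<Sum>i<Suc J. \<Sum>k\<in>{Suc i..<Suc J}. a i * a k)
      = (\<Sum>i<J. (\<Sum>k\<in>{Suc i..<J}. a i * a k) + a i * a J)"
    by (simp add: sum.atLeastLessThan_Suc)
  also have "\<dots> = (\<Sum>i<J. \<Sum>k\<in>{Suc i..<J}. a i * a k) + (\<Sum>i<J. a i) * a J"
    by (simp add: sum.distrib sum_distrib_right)
  finally show ?case using Suc.IH by (simp add: power2_sum algebra_simps)
qed simp

locale sieve = positive_walk M \<xi> for M :: "'a measure" and \<xi> +
  fixes U :: "nat \<Rightarrow> 'a \<Rightarrow> real"
  assumes U_indep: "indep_vars (\<lambda>_. borel) U {1..}"
    and U_uniform: "\<And>i. i \<ge> 1 \<Longrightarrow> distr M borel (U i) = uniform_measure lborel {0..1}"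
    and walk_U_indep: "indep_var
      (Pi\<^sub>M {1..} (\<lambda>_. borel)) (\<lambda>w. \<lambda>j\<in>{1..}. \<xi> j w)
      (Pi\<^sub>M {1..} (\<lambda>_. borel)) (\<lambda>w. \<lambda>i\<in>{1..}. U i w)"
    and log_integrable: "integrable M (\<lambda>w. ln (1 - exp (- \<xi> 1 w)))"
begin

definition cell :: "nat \<Rightarrow> 'a \<Rightarrow> real set" where
  "cell k w = {1 - exp (- S k w)<..<1 - exp (- S (Suc k) w)}"

definition occupied :: "nat \<Rightarrow> 'a \<Rightarrow> nat set" where
  "occupied n w = {k. \<exists>l\<in>{1..n}. U l w \<in> cell k w}"

text \<open>
  The indicator that cell \<open>k\<close> starts at depth at most \<open>t\<close> and is missed by the first \<open>n\<close> balls.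
\<close>

definition gap :: "real \<Rightarrow> nat \<Rightarrow> nat \<Rightarrow> 'a \<Rightarrow> real" where
  "gap t n k w = indicator {..t} (S k w) * (if k \<in> occupied n w then 0 else 1)"

definition deep_count :: "nat \<Rightarrow> 'a \<Rightarrow> real" where
  "deep_count n w = (\<Sum>l\<in>{1..n}. indicator {1 - 1 / real n<..} (U l w))"

lemma U_measurable: "l \<ge> 1 \<Longrightarrow> U l \<in> borel_measurable M"
proof -
  have "\<forall>i\<in>{1..}. random_variable borel (U i)"
    using U_indep unfolding indep_vars_def by (rule conjunct1)
  then show "l \<ge> 1 \<Longrightarrow> U l \<in> borel_measurable M" by auto
qed

lemma occupied_measurable [measurable]: "{w \<in> space M. k \<in> occupied n w} \<in> sets M"
proof -
  have "{w \<in> space M. k \<in> occupied n w} = (\<Union>l\<in>{1..n}.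
      {w \<in> space M. 1 - exp (- S k w) < U l w \<and> U l w < 1 - exp (- S (Suc k) w)})"
    by (auto simp: occupied_def cell_def)
  also have "\<dots> \<in> sets M"
  proof (rule sets.finite_UN)
    fix l assume "l \<in> {1..n}"
    then have [measurable]: "U l \<in> borel_measurable M" by (intro U_measurable) auto
    show "{w \<in> space M. 1 - exp (- S k w) < U l w \<and> U l w < 1 - exp (- S (Suc k) w)} \<in> sets M"
      by measurable
  qed simp
  finally show ?thesis .
qed

lemma gap_measurable [measurable]: "gap t n k \<in> borel_measurable M"
  unfolding gap_def by measurable

lemma deep_count_measurable [measurable]: "deep_count n \<in> borel_measurable M"
  unfolding deep_count_def
proof (rule borel_measurable_sum)
  fix l assume "l \<in> {1..n}"
  then have [measurable]: "U l \<in> borel_measurable M" by (intro U_measurable) auto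
  show "(\<lambda>w. indicator {1 - 1 / real n<..} (U l w)) \<in> borel_measurable M" by measurable
qed

lemma gap_01: "gap t n k w = 0 \<or> gap t n k w = 1"
  by (auto simp: gap_def indicator_def)

lemma prob_U:
  assumes "l \<ge> 1" and [measurable]: "A \<in> sets borel"
  shows "prob (U l -` A \<inter> space M) = measure lborel (A \<inter> {0..1})"
proof -
  note [measurable] = U_measurable[OF assms(1)]
  have "prob (U l -` A \<inter> space M) = measure (distr M borel (U l)) A"
    by (rule measure_distr[symmetric]) auto
  also have "\<dots> = measure (uniform_measure lborel {0..1}) A" by (simp only: U_uniform[OF assms(1)])
  also have "\<dots> = measure lborel ({0..1} \<inter> A) / measure lborel {0..1::real}"
    by (rule measure_uniform_measure) auto
  finally show ?thesis by (simp add: Int_commute)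
qed

lemma prob_all_miss:
  assumes [measurable]: "A \<in> sets borel" and A: "A \<subseteq> {0..1}"
  shows "prob {w \<in> space M. \<forall>l\<in>{1..n}. U l w \<notin> A} = (1 - measure lborel A) ^ n"
proof (cases "n = 0")
  case False
  have "{w \<in> space M. \<forall>l\<in>{1..n}. U l w \<notin> A} = (\<Inter>l\<in>{1..n}. U l -` (- A) \<inter> space M)"
    using False by auto
  also have "prob \<dots> = (\<Prod>l\<in>{1..n}. prob (U l -` (- A) \<inter> space M))"
    by (rule indep_varsD[OF U_indep]) (use False in auto)
  also have "\<dots> = (\<Prod>l\<in>{1..n}. 1 - measure lborel A)"
  proof (rule prod.cong)
    fix l assume "l \<in> {1..n}"
    then have "prob (U l -` (- A) \<inter> space M) = measure lborel (- A \<inter> {0..1})"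
      by (intro prob_U) auto
    also have "- A \<inter> {0..1} = {0..1} - A" by auto
    also have "measure lborel \<dots> = measure lborel {0..1::real} - measure lborel A"
      by (rule measure_Diff) (use A in auto)
    finally show "prob (U l -` (- A) \<inter> space M) = 1 - measure lborel A" by simp
  qed simp
  finally show ?thesis by simp
qed (simp add: prob_space)

lemma cell_subset: "w \<in> space M \<Longrightarrow> cell k w \<subseteq> {0..1}"
proof
  fix x assume w: "w \<in> space M" and "x \<in> cell k w"
  then have "1 - exp (- S k w) < x" "x < 1 - exp (- S (Suc k) w)" by (auto simp: cell_def)
  moreover have "exp (- S k w) \<le> 1" using S_nonneg[OF w] by simp
  ultimately show "x \<in> {0..1}"
    unfolding atLeastAtMost_iff using exp_gt_zero[of "- S (Suc k) w"] by linarith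
qed

lemma cell_disjoint:
  assumes w: "w \<in> space M" and "x \<in> cell j w" "x \<in> cell k w"
  shows "j = k"
proof -
  have False if "x \<in> cell j w" "x \<in> cell k w" "j < k" for j k
  proof -
    have "exp (- S k w) \<le> exp (- S (Suc j) w)" using S_mono[OF w, of "Suc j" k] that by simp
    moreover have "x < 1 - exp (- S (Suc j) w)" "1 - exp (- S k w) < x" using that by (auto simp: cell_def)
    ultimately show False by linarith
  qed
  then show ?thesis using assms by (metis linorder_neqE_nat)
qed

lemma measure_cells:
  assumes w: "w \<in> space M" and "finite A"
  shows "measure lborel (\<Union>k\<in>A. cell k w) = (\<Sum>k\<in>A. exp (- S k w) - exp (- S (Suc k) w))"
proof -
  have "measure lborel (\<Union>k\<in>A. cell k w) = (\<Sum>k\<in>A. measure lborel (cell k w))"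
  proof (rule measure_finite_Union[OF \<open>finite A\<close>])
    show "disjoint_family_on (\<lambda>k. cell k w) A"
      using cell_disjoint[OF w] by (auto simp: disjoint_family_on_def)
  next
    fix k
    show "emeasure lborel (cell k w) \<noteq> \<infinity>"
      using S_mono[OF w, of k "Suc k"] by (simp add: cell_def)
  qed (auto simp: cell_def)
  also have "\<dots> = (\<Sum>k\<in>A. exp (- S k w) - exp (- S (Suc k) w))"
    using S_mono[OF w, of _ "Suc _"] by (intro sum.cong) (auto simp: cell_def)
  finally show ?thesis .
qed

text \<open>
  Given the walk, the cells are disjoint fixed intervals, so all cells in \<open>A\<close> are missed with probability
  \<open>(1 - p) ^ n \<le> exp (- n * p)\<close>, where \<open>p\<close> is their total length. The upper bound is a product over the cells,
  although the events themselves are not independent.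
\<close>

lemma expectation_gaps_le:
  assumes n: "n \<ge> 1" and A: "finite A"
  shows "expectation (\<lambda>w. \<Prod>k\<in>A. gap (ln (real n)) n k w)
    \<le> expectation (\<lambda>w. \<Prod>k\<in>A. gap_damping (ln (real n)) k w)"
proof -
  define t where "t = ln (real n)"
  let ?P = "PiM {1..} (\<lambda>_. borel) :: (nat \<Rightarrow> real) measure"
  define X where "X w = (\<lambda>j\<in>{1..}. \<xi> j w)" for w
  define V where "V w = (\<lambda>l\<in>{1..}. U l w)" for w
  define s where "s k x = (\<Sum>i<k. x (Suc i))" for k and x :: "nat \<Rightarrow> real"
  define F where "F z = (\<Prod>k\<in>A. indicator {..t} (s k (fst z))
     * (if \<exists>l\<in>{1..n}. 1 - exp (- s k (fst z)) < snd z l \<and> snd z l < 1 - exp (- s (Suc k) (fst z))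
        then 0 else 1 :: real))" for z :: "(nat \<Rightarrow> real) \<times> (nat \<Rightarrow> real)"
  have [measurable]: "(\<lambda>x. x (Suc i)) \<in> borel_measurable ?P" for i
    by (rule measurable_component_singleton) simp
  have [measurable]: "s k \<in> borel_measurable ?P" for k
    unfolding s_def by measurable
  have snd_meas: "(\<lambda>z. snd z l) \<in> borel_measurable (?P \<Otimes>\<^sub>M ?P)" if "l \<in> {1..n}" for l
    by (rule measurable_compose[OF measurable_snd measurable_component_singleton]) (use that in auto)
  have [measurable]: "F \<in> borel_measurable (?P \<Otimes>\<^sub>M ?P)"
    unfolding F_def
  proof (intro borel_measurable_prod borel_measurable_times measurable_If)
    fix k
    show "(\<lambda>z. indicator {..t} (s k (fst z))) \<in> borel_measurable (?P \<Otimes>\<^sub>M ?P)" by measurable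
    have "{z \<in> space (?P \<Otimes>\<^sub>M ?P). \<exists>l\<in>{1..n}. 1 - exp (- s k (fst z)) < snd z l \<and> snd z l < 1 - exp (- s (Suc k) (fst z))}
      = (\<Union>l\<in>{1..n}. {z \<in> space (?P \<Otimes>\<^sub>M ?P). 1 - exp (- s k (fst z)) < snd z l \<and> snd z l < 1 - exp (- s (Suc k) (fst z))})"
      by auto
    also have "\<dots> \<in> sets (?P \<Otimes>\<^sub>M ?P)"
    proof (rule sets.finite_UN)
      fix l assume "l \<in> {1..n}"
      note [measurable] = snd_meas[OF this]
      show "{z \<in> space (?P \<Otimes>\<^sub>M ?P). 1 - exp (- s k (fst z)) < snd z l \<and> snd z l < 1 - exp (- s (Suc k) (fst z))}
          \<in> sets (?P \<Otimes>\<^sub>M ?P)" by measurable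
    qed simp
    finally show "{z \<in> space (?P \<Otimes>\<^sub>M ?P). \<exists>l\<in>{1..n}. 1 - exp (- s k (fst z)) < snd z l \<and> snd z l < 1 - exp (- s (Suc k) (fst z))}
      \<in> sets (?P \<Otimes>\<^sub>M ?P)" .
  qed auto
  have sX: "s k (X w) = S k w" for k w by (simp add: s_def X_def S_def)
  have F_eq: "F (X w, V w') = (\<Prod>k\<in>A. indicator {..t} (S k w))
      * indicator {w' \<in> space M. \<forall>l\<in>{1..n}. U l w' \<notin> (\<Union>k\<in>A. cell k w)} w'" if "w' \<in> space M" for w w'
  proof -
    have "(\<exists>l\<in>{1..n}. 1 - exp (- s k (X w)) < V w' l \<and> V w' l < 1 - exp (- s (Suc k) (X w)))
       \<longleftrightarrow> (\<exists>l\<in>{1..n}. U l w' \<in> cell k w)" for k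
      by (simp add: sX V_def cell_def)
    then have "F (X w, V w') = (\<Prod>k\<in>A. indicator {..t} (S k w))
        * (\<Prod>k\<in>A. if \<exists>l\<in>{1..n}. U l w' \<in> cell k w then 0 else 1)"
      unfolding F_def fst_conv snd_conv prod.distrib by (simp only: sX)
    also have "(\<Prod>k\<in>A. if \<exists>l\<in>{1..n}. U l w' \<in> cell k w then 0 else 1 :: real)
        = indicator {w' \<in> space M. \<forall>l\<in>{1..n}. U l w' \<notin> (\<Union>k\<in>A. cell k w)} w'"
    proof (cases "\<exists>k\<in>A. \<exists>l\<in>{1..n}. U l w' \<in> cell k w")
      case True
      then have "(\<Prod>k\<in>A. if \<exists>l\<in>{1..n}. U l w' \<in> cell k w then 0 else 1 :: real) = 0"
        using A by (intro prod_zero) auto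
      then show ?thesis using True by (auto simp: indicator_def)
    next
      case False
      then show ?thesis using that by (auto simp: indicator_def intro!: prod.neutral)
    qed
    finally show ?thesis .
  qed
  have gaps: "(\<Prod>k\<in>A. gap t n k w) = F (X w, V w)" for w
    unfolding F_def gap_def by (intro prod.cong) (simp_all add: sX V_def occupied_def cell_def)
  have F_nonneg: "0 \<le> F z" for z unfolding F_def by (intro prod_nonneg) auto
  have inner: "(\<integral>\<^sup>+w'. ennreal (F (X w, V w')) \<partial>M) \<le> ennreal (\<Prod>k\<in>A. gap_damping t k w)"
    if w: "w \<in> space M" for w
  proof -
    define p where "p = (\<Sum>k\<in>A. exp (- S k w) - exp (- S (Suc k) w))"
    define B where "B = {w' \<in> space M. \<forall>l\<in>{1..n}. U l w' \<notin> (\<Union>k\<in>A. cell k w)}"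
    have cells: "(\<Union>k\<in>A. cell k w) \<in> sets borel" "(\<Union>k\<in>A. cell k w) \<subseteq> {0..1}"
      using A cell_subset[OF w] by (auto simp: cell_def)
    have B_prob: "prob B = (1 - p) ^ n"
      unfolding B_def p_def prob_all_miss[OF cells] measure_cells[OF w A] ..
    have p: "p \<le> 1"
    proof -
      have "measure lborel (\<Union>k\<in>A. cell k w) \<le> measure lborel {0..1::real}"
        by (rule measure_mono_fmeasurable[OF cells(2)]) (use cells in \<open>auto simp: fmeasurable_def\<close>)
      then show ?thesis by (simp add: measure_cells[OF w A] p_def)
    qed
    have B_meas [measurable]: "B \<in> sets M"
    proof -
      have "B = space M - (\<Union>l\<in>{1..n}. U l -` (\<Union>k\<in>A. cell k w) \<inter> space M)" by (auto simp: B_def)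
      also have "\<dots> \<in> sets M"
        using A U_measurable by (intro sets.Diff sets.finite_UN sets.top measurable_sets) (auto simp: cell_def)
      finally show ?thesis .
    qed
    have "(\<integral>\<^sup>+w'. ennreal (F (X w, V w')) \<partial>M)
        = (\<integral>\<^sup>+w'. ennreal (\<Prod>k\<in>A. indicator {..t} (S k w)) * indicator B w' \<partial>M)"
      by (rule nn_integral_cong) (simp add: F_eq B_def indicator_def)
    also have "\<dots> = ennreal (\<Prod>k\<in>A. indicator {..t} (S k w)) * ennreal ((1 - p) ^ n)"
      by (simp add: nn_integral_cmult_indicator emeasure_eq_measure B_prob)
    also have "\<dots> = ennreal ((\<Prod>k\<in>A. indicator {..t} (S k w)) * (1 - p) ^ n)"
      using p by (subst ennreal_mult) (auto intro!: prod_nonneg)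
    also have "\<dots> \<le> ennreal ((\<Prod>k\<in>A. indicator {..t} (S k w)) * exp (- (real n * p)))"
    proof (intro ennreal_leI mult_left_mono)
      have "(1 - p) ^ n \<le> exp (- p) ^ n" using p exp_ge_add_one_self[of "- p"] by (intro power_mono) auto
      then show "(1 - p) ^ n \<le> exp (- (real n * p))" by (simp add: exp_of_nat_mult[symmetric])
    qed (auto intro: prod_nonneg)
    also have "exp (- (real n * p)) = (\<Prod>k\<in>A. exp (- (exp (t - S k w) * (1 - exp (- \<xi> (Suc k) w)))))"
    proof -
      have "real n * (exp (- S k w) - exp (- S (Suc k) w)) = exp (t - S k w) * (1 - exp (- \<xi> (Suc k) w))" for k
        using n by (simp add: t_def exp_diff exp_minus exp_add S_Suc field_simps)
      then show ?thesis using A by (simp add: p_def sum_distrib_left exp_sum[symmetric] sum_negf)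
    qed
    also have "(\<Prod>k\<in>A. indicator {..t} (S k w)) * (\<Prod>k\<in>A. exp (- (exp (t - S k w) * (1 - exp (- \<xi> (Suc k) w)))))
        = (\<Prod>k\<in>A. gap_damping t k w)"
      by (simp add: gap_damping_def prod.distrib)
    finally show ?thesis .
  qed
  have gap_int: "integrable M (\<lambda>w. \<Prod>k\<in>A. gap t n k w)"
  proof (rule integrable_const_bound[of _ 1])
    have "\<bar>\<Prod>k\<in>A. gap t n k w\<bar> \<le> 1" for w
      unfolding abs_prod by (rule prod_le_1) (use gap_01[of t n] in \<open>metis abs_0 abs_1 order_refl zero_le_one\<close>)
    then show "AE w in M. norm (\<Prod>k\<in>A. gap t n k w) \<le> 1" by simp
  qed measurable
  have damp: "0 \<le> (\<Prod>k\<in>A. gap_damping t k w) \<and> (\<Prod>k\<in>A. gap_damping t k w) \<le> 1" if "w \<in> space M" for w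
    using gap_damping_bounds[OF that] by (auto intro!: prod_nonneg prod_le_1)
  have damp_int: "integrable M (\<lambda>w. \<Prod>k\<in>A. gap_damping t k w)"
    by (rule integrable_const_bound[of _ 1]) (use damp in auto)
  have "ennreal (expectation (\<lambda>w. \<Prod>k\<in>A. gap t n k w)) = (\<integral>\<^sup>+w. ennreal (F (X w, V w)) \<partial>M)"
    using gap_int F_nonneg by (subst nn_integral_eq_integral[symmetric]) (auto simp: gaps)
  also have "\<dots> = (\<integral>\<^sup>+w. \<integral>\<^sup>+w'. ennreal (F (X w, V w')) \<partial>M \<partial>M)"
    unfolding X_def V_def by (rule nn_integral_indep_pair[OF walk_U_indep, of "\<lambda>z. ennreal (F z)"]) measurable
  also have "\<dots> \<le> (\<integral>\<^sup>+w. ennreal (\<Prod>k\<in>A. gap_damping t k w) \<partial>M)"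
    by (rule nn_integral_mono) (rule inner)
  also have "\<dots> = ennreal (expectation (\<lambda>w. \<Prod>k\<in>A. gap_damping t k w))"
    using damp_int damp by (intro nn_integral_eq_integral) auto
  finally have "expectation (\<lambda>w. \<Prod>k\<in>A. gap t n k w) \<le> expectation (\<lambda>w. \<Prod>k\<in>A. gap_damping t k w)"
    using damp by (subst (asm) ennreal_le_iff) (auto intro!: Bochner_Integration.integral_nonneg_AE)
  then show ?thesis by (simp add: t_def)
qed

text \<open>
  The square of the count is the count plus twice the number of pairs of gaps. For a pair \<open>i < k\<close> the
  damping factor of \<open>i\<close> is known at time \<open>i + 1\<close> and serves as weight for the sum over \<open>k\<close>, so every
  summation contributes one factor \<open>b\<close>.
\<close>

lemma gap_count_second_moment:
  obtains C where "C \<ge> 0"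
    "\<And>n J. n \<ge> 1 \<Longrightarrow> expectation (\<lambda>w. (\<Sum>k<J. gap (ln (real n)) n k w)\<^sup>2) \<le> C"
proof -
  obtain b where b: "b \<ge> 0"
    "\<And>Y i t J. \<lbrakk>Y \<in> borel_measurable (past i); integrable M Y; \<And>w. w \<in> space M \<Longrightarrow> 0 \<le> Y w\<rbrakk>
      \<Longrightarrow> (\<Sum>k\<in>{i..<J}. expectation (\<lambda>w. Y w * gap_damping t k w)) \<le> b * expectation Y"
    using gap_potential_bound[OF log_integrable] by blast
  have "expectation (\<lambda>w. (\<Sum>k<J. gap (ln (real n)) n k w)\<^sup>2) \<le> b + 2 * (b * b)" if n: "n \<ge> 1" for n J
  proof -
    define t where "t = ln (real n)"
    define g where "g k = gap t n k" for k
    define e where "e k = gap_damping t k" for k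
    have [measurable]: "g k \<in> borel_measurable M" for k by (simp add: g_def)
    have gg: "integrable M (\<lambda>w. g i w * g k w)" for i k
    proof (rule integrable_const_bound[of _ 1])
      have "\<bar>g i w * g k w\<bar> \<le> 1" for w
        using gap_01[of t n i w] gap_01[of t n k w] by (auto simp: g_def)
      then show "AE w in M. norm (g i w * g k w) \<le> 1" by simp
    qed measurable
    have g1: "integrable M (g k)" for k
    proof (rule integrable_const_bound[of _ 1])
      have "\<bar>g k w\<bar> \<le> 1" for w using gap_01[of t n k w] by (auto simp: g_def)
      then show "AE w in M. norm (g k w) \<le> 1" by simp
    qed measurable
    have single: "expectation (g k) \<le> expectation (e k)" for k
      using expectation_gaps_le[OF n, of "{k}"] by (simp add: g_def e_def t_def)
    have pair: "expectation (\<lambda>w. g i w * g k w) \<le> expectation (\<lambda>w. e i w * e k w)" if "i \<noteq> k" for i k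
      using expectation_gaps_le[OF n, of "{i, k}"] that by (simp add: g_def e_def t_def)
    have "(\<Sum>k\<in>{0..<J}. expectation (\<lambda>w. 1 * gap_damping t k w)) \<le> b * expectation (\<lambda>_. 1)"
      by (rule b(2)) auto
    then have sum_e: "(\<Sum>k<J. expectation (e k)) \<le> b"
      by (simp add: e_def prob_space lessThan_atLeast0)
    have later: "(\<Sum>k\<in>{Suc i..<J}. expectation (\<lambda>w. e i w * e k w)) \<le> b * expectation (e i)" for i
      unfolding e_def using gap_damping_measurable_past integrable_gap_damping gap_damping_bounds
      by (intro b(2)) auto
    have "(\<lambda>w. (\<Sum>k<J. g k w)\<^sup>2) = (\<lambda>w. (\<Sum>k<J. g k w) + 2 * (\<Sum>i<J. \<Sum>k\<in>{Suc i..<J}. g i w * g k w))"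
    proof
      fix w
      have "(g k w)\<^sup>2 = g k w" for k using gap_01[of t n k w] by (auto simp: g_def)
      then show "(\<Sum>k<J. g k w)\<^sup>2 = (\<Sum>k<J. g k w) + 2 * (\<Sum>i<J. \<Sum>k\<in>{Suc i..<J}. g i w * g k w)"
        by (simp add: sum_square_pairs)
    qed
    then have "expectation (\<lambda>w. (\<Sum>k<J. g k w)\<^sup>2)
        = (\<Sum>k<J. expectation (g k)) + 2 * (\<Sum>i<J. \<Sum>k\<in>{Suc i..<J}. expectation (\<lambda>w. g i w * g k w))"
      using g1 gg by simp
    also have "\<dots> \<le> (\<Sum>k<J. expectation (e k)) + 2 * (\<Sum>i<J. \<Sum>k\<in>{Suc i..<J}. expectation (\<lambda>w. e i w * e k w))"
      by (intro add_mono mult_left_mono sum_mono single pair) auto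
    also have "\<dots> \<le> b + 2 * (\<Sum>i<J. b * expectation (e i))"
      by (intro add_mono mult_left_mono sum_mono later sum_e) auto
    also have "\<dots> = b + 2 * (b * (\<Sum>i<J. expectation (e i)))" by (simp add: sum_distrib_left)
    also have "\<dots> \<le> b + 2 * (b * b)"
      using sum_e b(1) by (intro add_mono mult_left_mono) auto
    finally show ?thesis by (simp add: g_def t_def)
  qed
  moreover have "b + 2 * (b * b) \<ge> 0" using b(1) by simp
  ultimately show ?thesis using that by blast
qed

lemma deep_count_second_moment:
  assumes n: "n \<ge> 1"
  shows "expectation (\<lambda>w. (deep_count n w)\<^sup>2) \<le> 2"
proof -
  define D where "D l = U l -` {1 - 1 / real n<..} \<inter> space M" for l
  have D_meas [measurable]: "D l \<in> sets M" if "l \<in> {1..n}" for l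
    unfolding D_def using U_measurable[of l] that by (intro measurable_sets) auto
  have single: "prob (D l) = 1 / real n" if "l \<in> {1..n}" for l
  proof -
    have "prob (D l) = measure lborel ({1 - 1 / real n<..} \<inter> {0..1})"
      unfolding D_def by (rule prob_U) (use that in auto)
    also have "{1 - 1 / real n<..} \<inter> {0..1} = {1 - 1 / real n<..1}"
    proof -
      have "1 / real n \<le> 1" using n by simp
      then show ?thesis by auto
    qed
    finally show ?thesis by simp
  qed
  have pair: "prob (D l \<inter> D m) \<le> 1 / (real n)\<^sup>2 + (if l = m then 1 / real n else 0)"
    if l: "l \<in> {1..n}" and m: "m \<in> {1..n}" for l m
  proof (cases "l = m")
    case True
    then show ?thesis using single[OF l] by simp
  next
    case False
    have "prob (\<Inter>i\<in>{l, m}. U i -` {1 - 1 / real n<..} \<inter> space M) = (\<Prod>i\<in>{l, m}. prob (U i -` {1 - 1 / real n<..} \<inter> space M))"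
      by (rule indep_varsD[OF U_indep]) (use l m in auto)
    then have "prob (D l \<inter> D m) = prob (D l) * prob (D m)"
      using False by (simp add: D_def)
    then show ?thesis using False single l m by (simp add: power2_eq_square)
  qed
  have "expectation (\<lambda>w. (deep_count n w)\<^sup>2) = expectation (\<lambda>w. \<Sum>l\<in>{1..n}. \<Sum>m\<in>{1..n}. indicat_real (D l \<inter> D m) w)"
  proof (rule Bochner_Integration.integral_cong)
    fix w assume "w \<in> space M"
    then have "deep_count n w = (\<Sum>l\<in>{1..n}. indicat_real (D l) w)"
      unfolding deep_count_def D_def by (intro sum.cong) (auto simp: indicator_def)
    then show "(deep_count n w)\<^sup>2 = (\<Sum>l\<in>{1..n}. \<Sum>m\<in>{1..n}. indicat_real (D l \<inter> D m) w)"
      by (simp add: power2_eq_square sum_product indicator_inter_arith)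
  qed simp
  also have "\<dots> = (\<Sum>l\<in>{1..n}. \<Sum>m\<in>{1..n}. prob (D l \<inter> D m))"
  proof -
    have int: "integrable M (indicat_real (D l \<inter> D m))" if "l \<in> {1..n}" "m \<in> {1..n}" for l m
      using D_meas that by (intro integrable_real_indicator) (auto simp: emeasure_eq_measure)
    have "D l \<inter> D m \<inter> space M = D l \<inter> D m" for l m by (auto simp: D_def)
    then have "expectation (indicat_real (D l \<inter> D m)) = prob (D l \<inter> D m)" for l m by simp
    moreover have "expectation (\<lambda>w. \<Sum>l\<in>{1..n}. \<Sum>m\<in>{1..n}. indicat_real (D l \<inter> D m) w)
        = (\<Sum>l\<in>{1..n}. expectation (\<lambda>w. \<Sum>m\<in>{1..n}. indicat_real (D l \<inter> D m) w))"
      using int by (intro Bochner_Integration.integral_sum Bochner_Integration.integrable_sum)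
    moreover have "expectation (\<lambda>w. \<Sum>m\<in>{1..n}. indicat_real (D l \<inter> D m) w)
        = (\<Sum>m\<in>{1..n}. expectation (indicat_real (D l \<inter> D m)))" if "l \<in> {1..n}" for l
      using int that by (intro Bochner_Integration.integral_sum)
    ultimately show ?thesis by simp
  qed
  also have "\<dots> \<le> (\<Sum>l\<in>{1..n}. \<Sum>m\<in>{1..n}. 1 / (real n)\<^sup>2 + (if l = m then 1 / real n else 0))"
    by (intro sum_mono pair)
  also have "\<dots> = (\<Sum>l\<in>{1..n}. real n * (1 / (real n)\<^sup>2) + 1 / real n)"
    by (intro sum.cong) (auto simp: sum.distrib)
  also have "\<dots> = 2" using n by (simp add: power2_eq_square field_simps)
  finally show ?thesis .
qed

lemma card_hit_cells:
  assumes w: "w \<in> space M" and L: "finite L"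
  shows "finite {k. \<exists>l\<in>L. U l w \<in> cell k w}" "card {k. \<exists>l\<in>L. U l w \<in> cell k w} \<le> card L"
proof -
  have "k = (SOME k. U l w \<in> cell k w)" if "U l w \<in> cell k w" for k l
    using cell_disjoint[OF w that someI[of "\<lambda>k. U l w \<in> cell k w", OF that]] .
  then have sub: "{k. \<exists>l\<in>L. U l w \<in> cell k w} \<subseteq> (\<lambda>l. SOME k. U l w \<in> cell k w) ` L" by blast
  show "finite {k. \<exists>l\<in>L. U l w \<in> cell k w}" using finite_subset[OF sub] L by simp
  have "card {k. \<exists>l\<in>L. U l w \<in> cell k w} \<le> card ((\<lambda>l. SOME k. U l w \<in> cell k w) ` L)"
    using sub L by (intro card_mono) auto
  also have "\<dots> \<le> card L" by (rule card_image_le[OF L])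
  finally show "card {k. \<exists>l\<in>L. U l w \<in> cell k w} \<le> card L" .
qed

text \<open>
  Every cell that starts at depth at most \<open>t\<close> and before index \<open>J\<close> is either occupied or a gap. The other
  occupied cells are those from index \<open>J\<close> on that still start at depth at most \<open>t\<close>, which exist only if
  the walk is slow, and those starting beyond \<open>t\<close>, each of which holds a ball above
  \<open>1 - exp (- t) = 1 - 1 / n\<close>.
\<close>

lemma occupied_vs_passage:
  assumes w: "w \<in> space M" and n: "n \<ge> 1"
  defines "t \<equiv> ln (real n)"
  shows "\<bar>real (card (occupied n w)) - passage t J w\<bar>
    \<le> (\<Sum>k<J. gap t n k w) + real n * indicator {..t} (S J w) + deep_count n w"
proof -
  let ?O = "occupied n w"
  have O: "finite ?O" "card ?O \<le> n"
    using card_hit_cells[OF w, of "{1..n}"] by (simp_all add: occupied_def)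
  let ?early = "{k. k < J \<and> S k w \<le> t}"
  let ?late = "?O \<inter> {k. J \<le> k \<and> S k w \<le> t}" and ?beyond = "?O \<inter> {k. t < S k w}"
  have split: "card ?O = card (?O \<inter> ?early) + card ?late + card ?beyond"
  proof -
    have O_eq: "?O = ((?O \<inter> ?early) \<union> ?late) \<union> ?beyond" by auto
    have "card ?O = card ((?O \<inter> ?early) \<union> ?late) + card ?beyond"
      by (subst O_eq, rule card_Un_disjoint) (use O in auto)
    moreover have "card ((?O \<inter> ?early) \<union> ?late) = card (?O \<inter> ?early) + card ?late"
      by (rule card_Un_disjoint) (use O in auto)
    ultimately show ?thesis by simp
  qed
  have p: "passage t J w = (\<Sum>k<J. of_bool (S k w \<le> t))"
    unfolding passage_def by (rule sum.cong) (auto simp: indicator_def)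
  have g: "(\<Sum>k<J. gap t n k w) = (\<Sum>k<J. of_bool (S k w \<le> t \<and> k \<notin> ?O))"
    unfolding gap_def by (rule sum.cong) (auto simp: indicator_def)
  have "card ?early = card (?O \<inter> ?early) + card (?early - ?O)"
    using card_Int_Diff[of ?early ?O] by (simp add: Int_commute)
  moreover have "passage t J w = real (card ?early)"
    unfolding p by (simp add: Int_def lessThan_def)
  moreover have "(\<Sum>k<J. gap t n k w) = real (card (?early - ?O))"
    unfolding g by (simp add: Int_def lessThan_def set_diff_eq conj_assoc)
  ultimately have early: "passage t J w = real (card (?O \<inter> ?early)) + (\<Sum>k<J. gap t n k w)"
    by simp
  have late: "real (card ?late) \<le> real n * indicator {..t} (S J w)"
  proof (cases "S J w \<le> t")
    case True
    have "card ?late \<le> card ?O" by (rule card_mono) (use O in auto)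
    then show ?thesis using True O by simp
  next
    case False
    have "?late = {}"
    proof -
      have False if "J \<le> k" "S k w \<le> t" for k using S_mono[OF w that(1)] that False by simp
      then show ?thesis by auto
    qed
    then show ?thesis by simp
  qed
  let ?L = "{l \<in> {1..n}. 1 - 1 / real n < U l w}"
  have "?beyond \<subseteq> {k. \<exists>l\<in>?L. U l w \<in> cell k w}"
  proof
    fix k assume "k \<in> ?beyond"
    then obtain l where l: "l \<in> {1..n}" "U l w \<in> cell k w" and k: "t < S k w" by (auto simp: occupied_def)
    have "exp (- S k w) \<le> exp (- t)" using k by simp
    also have "exp (- t) = 1 / real n" using n by (simp add: t_def exp_minus inverse_eq_divide)
    finally have "1 - 1 / real n < U l w" using l by (auto simp: cell_def)
    then show "k \<in> {k. \<exists>l\<in>?L. U l w \<in> cell k w}" using l by blast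
  qed
  then have "card ?beyond \<le> card {k. \<exists>l\<in>?L. U l w \<in> cell k w}"
    using card_hit_cells(1)[OF w, of ?L] by (intro card_mono) auto
  also have "\<dots> \<le> card ?L" by (rule card_hit_cells(2)[OF w]) simp
  also have "real (card ?L) = deep_count n w"
  proof -
    have "deep_count n w = (\<Sum>l\<in>{1..n}. of_bool (1 - 1 / real n < U l w))"
      unfolding deep_count_def by (rule sum.cong) (auto simp: indicator_def)
    then show ?thesis by (simp add: Int_def)
  qed
  finally have beyond: "real (card ?beyond) \<le> deep_count n w" by simp
  have "0 \<le> (\<Sum>k<J. gap t n k w)" unfolding g by (simp add: sum_nonneg)
  then show ?thesis using split early late beyond by simp
qed

lemma card_occupied_measurable [measurable]: "(\<lambda>w. real (card (occupied n w))) \<in> borel_measurable M"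
proof -
  have "(\<lambda>w. card (occupied n w)) \<in> M \<rightarrow>\<^sub>M count_space UNIV"
    by (rule measurable_card) (rule occupied_measurable)
  then show ?thesis by (rule measurable_compose) simp
qed

lemma card_occupied_square_integrable: "integrable M (\<lambda>w. (real (card (occupied n w)))\<^sup>2)"
proof (rule integrable_const_bound[of _ "(real n)\<^sup>2"])
  show "AE w in M. norm ((real (card (occupied n w)))\<^sup>2) \<le> (real n)\<^sup>2"
  proof (rule AE_I2)
    fix w assume w: "w \<in> space M"
    have "card (occupied n w) \<le> n" using card_hit_cells(2)[OF w, of "{1..n}"] by (simp add: occupied_def)
    then show "norm ((real (card (occupied n w)))\<^sup>2) \<le> (real n)\<^sup>2" by (simp add: power_mono)
  qed
qed measurable

lemma occupied_minus_passage_square_integrable: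
  "integrable M (\<lambda>w. (real (card (occupied n w)) - passage t J w)\<^sup>2)"
  using integrable_square_add[OF _ _ card_occupied_square_integrable, where g="\<lambda>w. - passage t J w"]
    passage_square_integrable by simp

lemma occupied_minus_passage_second_moment:
  obtains C where "\<And>n J. n \<ge> 1 \<Longrightarrow>
    expectation (\<lambda>w. (real (card (occupied n w)) - passage (ln (real n)) J w)\<^sup>2)
    \<le> C + 3 * (real n)\<^sup>2 * expectation (\<lambda>w. indicat_real {..ln (real n)} (S J w))"
proof -
  obtain C where C: "C \<ge> 0"
    "\<And>n J. n \<ge> 1 \<Longrightarrow> expectation (\<lambda>w. (\<Sum>k<J. gap (ln (real n)) n k w)\<^sup>2) \<le> C"
    using gap_count_second_moment by blast
  show ?thesis
  proof (rule that[of "3 * C + 6"])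
    fix n J :: nat assume n: "n \<ge> 1"
    define t where "t = ln (real n)"
    define G where "G w = (\<Sum>k<J. gap t n k w)" for w
    have [measurable]: "G \<in> borel_measurable M" unfolding G_def by measurable
    have G2: "integrable M (\<lambda>w. (G w)\<^sup>2)"
    proof (rule integrable_const_bound[of _ "(real J)\<^sup>2"])
      have "\<bar>G w\<bar> \<le> real J" for w
      proof -
        have "\<bar>G w\<bar> \<le> (\<Sum>k<J. \<bar>gap t n k w\<bar>)" unfolding G_def by (rule sum_abs)
        also have "\<dots> \<le> (\<Sum>k<J. 1)"
          by (rule sum_mono) (use gap_01[of t n] in \<open>metis abs_0 abs_1 order_refl zero_le_one\<close>)
        finally show ?thesis by simp
      qed
      then have "\<bar>G w\<bar>\<^sup>2 \<le> (real J)\<^sup>2" for w by (intro power_mono) auto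
      then show "AE w in M. norm ((G w)\<^sup>2) \<le> (real J)\<^sup>2" by simp
    qed measurable
    have deep2: "integrable M (\<lambda>w. (deep_count n w)\<^sup>2)"
    proof (rule integrable_const_bound[of _ "(real n)\<^sup>2"])
      have "\<bar>deep_count n w\<bar> \<le> real n" for w
      proof -
        have "\<bar>deep_count n w\<bar> \<le> (\<Sum>l\<in>{1..n}. \<bar>indicator {1 - 1 / real n<..} (U l w)\<bar>)"
          unfolding deep_count_def by (rule sum_abs)
        also have "\<dots> \<le> (\<Sum>l\<in>{1..n}. 1)" by (rule sum_mono) (auto simp: indicator_def)
        finally show ?thesis by simp
      qed
      then have "\<bar>deep_count n w\<bar>\<^sup>2 \<le> (real n)\<^sup>2" for w by (intro power_mono) auto
      then show "AE w in M. norm ((deep_count n w)\<^sup>2) \<le> (real n)\<^sup>2" by simp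
    qed measurable
    have sq3: "(x + y + z)\<^sup>2 \<le> 3 * x\<^sup>2 + 3 * y\<^sup>2 + 3 * z\<^sup>2" for x y z :: real
    proof -
      have "0 \<le> (x - y)\<^sup>2 + (x - z)\<^sup>2 + (y - z)\<^sup>2" by simp
      then show ?thesis by (simp add: power2_eq_square algebra_simps)
    qed
    have "expectation (\<lambda>w. (real (card (occupied n w)) - passage t J w)\<^sup>2)
      \<le> expectation (\<lambda>w. 3 * (G w)\<^sup>2 + 3 * (real n)\<^sup>2 * indicat_real {..t} (S J w) + 3 * (deep_count n w)\<^sup>2)"
    proof (rule integral_mono[OF occupied_minus_passage_square_integrable])
      show "integrable M (\<lambda>w. 3 * (G w)\<^sup>2 + 3 * (real n)\<^sup>2 * indicat_real {..t} (S J w) + 3 * (deep_count n w)\<^sup>2)"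
        using G2 deep2 by simp
      fix w assume w: "w \<in> space M"
      have "\<bar>real (card (occupied n w)) - passage t J w\<bar>\<^sup>2
          \<le> (G w + real n * indicator {..t} (S J w) + deep_count n w)\<^sup>2"
        using occupied_vs_passage[OF w n, of J] by (intro power_mono) (auto simp: G_def t_def)
      also have "\<dots> \<le> 3 * (G w)\<^sup>2 + 3 * (real n * indicator {..t} (S J w))\<^sup>2 + 3 * (deep_count n w)\<^sup>2" by (rule sq3)
      finally show "(real (card (occupied n w)) - passage t J w)\<^sup>2
          \<le> 3 * (G w)\<^sup>2 + 3 * (real n)\<^sup>2 * indicat_real {..t} (S J w) + 3 * (deep_count n w)\<^sup>2"
        by (cases "S J w \<le> t") (simp_all add: power_mult_distrib)
    qed
    also have "\<dots> = 3 * expectation (\<lambda>w. (G w)\<^sup>2)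
        + 3 * (real n)\<^sup>2 * expectation (\<lambda>w. indicat_real {..t} (S J w)) + 3 * expectation (\<lambda>w. (deep_count n w)\<^sup>2)"
      using G2 deep2 by simp
    also have "\<dots> \<le> 3 * C + 3 * (real n)\<^sup>2 * expectation (\<lambda>w. indicat_real {..t} (S J w)) + 3 * 2"
      using C(2)[OF n, of J] deep_count_second_moment[OF n] by (simp add: G_def t_def)
    finally show "expectation (\<lambda>w. (real (card (occupied n w)) - passage (ln (real n)) J w)\<^sup>2)
      \<le> 3 * C + 6 + 3 * (real n)\<^sup>2 * expectation (\<lambda>w. indicat_real {..ln (real n)} (S J w))"
      by (simp add: t_def)
  qed
qed

theorem variance_card_occupied:
  "(\<lambda>n. variance (\<lambda>w. real (card (occupied n w))) / ln (real n)) \<longlonglongrightarrow> \<sigma>2 / \<mu> ^ 3"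
proof -
  define t where "t n = ln (real n)" for n
  have t0: "t n \<ge> 0" for n by (cases n) (simp_all add: t_def)
  have t_lim: "filterlim t at_top sequentially"
    unfolding t_def by (rule filterlim_compose[OF ln_at_top filterlim_real_sequentially])
  have t_pos: "\<forall>\<^sub>F n in sequentially. t n > 0"
    using t_lim by (simp add: filterlim_at_top_dense)
  define P where "P n J = expectation (\<lambda>w. indicat_real {..t n} (S J w))" for n J
  have P0: "P n J \<ge> 0" for n J by (simp add: P_def)
  have "\<exists>J. ((real n)\<^sup>2 + (t n)\<^sup>2) * P n J \<le> 1" for n
  proof -
    have "(\<lambda>J. ((real n)\<^sup>2 + (t n)\<^sup>2) * P n J) \<longlonglongrightarrow> ((real n)\<^sup>2 + (t n)\<^sup>2) * 0"
      unfolding P_def by (intro tendsto_intros S_tends_to_infinity t0)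
    then have "\<forall>\<^sub>F J in sequentially. ((real n)\<^sup>2 + (t n)\<^sup>2) * P n J < 1"
      by (intro order_tendstoD(2)[of _ 0]) auto
    then obtain J where "((real n)\<^sup>2 + (t n)\<^sup>2) * P n J < 1"
      using eventually_happens'[OF sequentially_bot] by blast
    then show ?thesis by (intro exI[of _ J]) simp
  qed
  \<comment> \<open>The cutoff outweighs both the at most \<open>n\<close> occupied cells and the distance at most \<open>t\<close> that a slow
    walk contributes.\<close>
  then obtain J where J: "\<And>n. ((real n)\<^sup>2 + (t n)\<^sup>2) * P n (J n) \<le> 1" by metis
  have J1: "(real n)\<^sup>2 * P n (J n) \<le> 1" and J2: "(t n)\<^sup>2 * P n (J n) \<le> 1" for n
    using J[of n] P0[of n "J n"] mult_nonneg_nonneg[OF zero_le_power2[of "real n"] P0[of n "J n"]]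
      mult_nonneg_nonneg[OF zero_le_power2[of "t n"] P0[of n "J n"]]
    unfolding distrib_right by linarith+
  define K where "K n w = real (card (occupied n w))" for n w
  define Q where "Q n w = passage (t n) (J n) w" for n w
  define F where "F n w = fluctuation (t n) (J n) w" for n w
  define Z where "Z n w = - F n w / \<mu>" for n w
  define D where "D n w = \<mu> * Q n w + F n w - t n" for n w
  have [measurable]: "K n \<in> borel_measurable M" "Q n \<in> borel_measurable M" "F n \<in> borel_measurable M"
    "Z n \<in> borel_measurable M" for n
    unfolding K_def Q_def F_def Z_def by measurable
  have [measurable]: "D n \<in> borel_measurable M" for n unfolding D_def by measurable
  have F2: "integrable M (\<lambda>w. (F n w)\<^sup>2)" and F0: "expectation (F n) = 0"
    and F2_eq: "expectation (\<lambda>w. (F n w)\<^sup>2) = \<sigma>2 * expectation (Q n)" for n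
    using fluctuation_moments[of "t n" "J n"] by (simp_all add: F_def[abs_def] Q_def[abs_def])
  note asym = passage_asymptotics[OF t_lim J2[unfolded P_def]]
  obtain C where C: "\<And>n J. n \<ge> 1 \<Longrightarrow>
    expectation (\<lambda>w. (real (card (occupied n w)) - passage (ln (real n)) J w)\<^sup>2)
    \<le> C + 3 * (real n)\<^sup>2 * expectation (\<lambda>w. indicat_real {..ln (real n)} (S J w))"
    using occupied_minus_passage_second_moment by blast
  have KQ: "expectation (\<lambda>w. (K n w - Q n w)\<^sup>2) \<le> C + 3" if "n \<ge> 1" for n
    using C[OF that, of "J n"] J1[of n] by (simp add: K_def Q_def P_def t_def)
  have KQ2: "integrable M (\<lambda>w. (K n w - Q n w)\<^sup>2)" for n
    unfolding K_def Q_def by (rule occupied_minus_passage_square_integrable)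
  have D2: "integrable M (\<lambda>w. (D n w)\<^sup>2)" for n
    unfolding D_def Q_def F_def by (rule overshoot_square_integrable)
  have "(\<lambda>n. variance (K n) / t n) \<longlonglongrightarrow> \<sigma>2 / \<mu> ^ 3"
  proof (rule tendsto_variance_ratio[where Z=Z and b="\<lambda>n. t n / \<mu>"])
    show "integrable M (\<lambda>w. (K n w)\<^sup>2)" for n
      unfolding K_def by (rule card_occupied_square_integrable)
    show "integrable M (\<lambda>w. (Z n w)\<^sup>2)" for n
      using F2 by (simp add: Z_def power_divide)
    show "expectation (Z n) = 0" for n
      using F0[of n] by (simp add: Z_def[abs_def])
    have "expectation (\<lambda>w. (Z n w)\<^sup>2) / t n = \<sigma>2 / \<mu>\<^sup>2 * (expectation (Q n) / t n)" for n
      using F2_eq[of n] by (simp add: Z_def power_divide)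
    moreover have "(\<lambda>n. \<sigma>2 / \<mu>\<^sup>2 * (expectation (Q n) / t n)) \<longlonglongrightarrow> \<sigma>2 / \<mu>\<^sup>2 * (1 / \<mu>)"
      using asym(2) by (intro tendsto_mult tendsto_const) (simp add: Q_def[abs_def])
    ultimately show "(\<lambda>n. expectation (\<lambda>w. (Z n w)\<^sup>2) / t n) \<longlonglongrightarrow> \<sigma>2 / \<mu> ^ 3"
      by (simp add: power2_eq_square power3_eq_cube mult.assoc)
    show "(\<lambda>n. expectation (\<lambda>w. (K n w - t n / \<mu> - Z n w)\<^sup>2) / t n) \<longlonglongrightarrow> 0"
    proof (rule Lim_null_comparison)
      have "(\<lambda>n. 2 * (C + 3) / t n + 2 / \<mu>\<^sup>2 * (expectation (\<lambda>w. (D n w)\<^sup>2) / t n)) \<longlonglongrightarrow> 0 + 2 / \<mu>\<^sup>2 * 0"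
        using asym(1) by (intro tendsto_add tendsto_mult tendsto_const tendsto_divide_0[OF tendsto_const]
            filterlim_at_top_imp_at_infinity[OF t_lim]) (simp add: D_def Q_def F_def)
      then show "(\<lambda>n. 2 * (C + 3) / t n + 2 / \<mu>\<^sup>2 * (expectation (\<lambda>w. (D n w)\<^sup>2) / t n)) \<longlonglongrightarrow> 0" by simp
      show "\<forall>\<^sub>F n in sequentially. norm (expectation (\<lambda>w. (K n w - t n / \<mu> - Z n w)\<^sup>2) / t n)
          \<le> 2 * (C + 3) / t n + 2 / \<mu>\<^sup>2 * (expectation (\<lambda>w. (D n w)\<^sup>2) / t n)"
        using t_pos eventually_ge_at_top[of 1]
      proof eventually_elim
        case (elim n)
        have decomp: "K n w - t n / \<mu> - Z n w = (K n w - Q n w) + D n w / \<mu>" for w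
          using \<mu>_pos by (simp add: Z_def D_def field_simps)
        have "expectation (\<lambda>w. (K n w - t n / \<mu> - Z n w)\<^sup>2)
            \<le> expectation (\<lambda>w. 2 * (K n w - Q n w)\<^sup>2 + 2 / \<mu>\<^sup>2 * (D n w)\<^sup>2)"
          unfolding decomp
        proof (rule integral_mono)
          show "integrable M (\<lambda>w. (K n w - Q n w + D n w / \<mu>)\<^sup>2)"
            using KQ2 D2 by (intro integrable_square_add) (auto simp: power_divide)
          show "integrable M (\<lambda>w. 2 * (K n w - Q n w)\<^sup>2 + 2 / \<mu>\<^sup>2 * (D n w)\<^sup>2)"
            using KQ2 D2 by simp
          fix w
          have sq2: "(x + y)\<^sup>2 \<le> 2 * x\<^sup>2 + 2 * y\<^sup>2" for x y :: real
            using sum_squares_bound[of x y] by (simp add: power2_sum)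
          show "(K n w - Q n w + D n w / \<mu>)\<^sup>2 \<le> 2 * (K n w - Q n w)\<^sup>2 + 2 / \<mu>\<^sup>2 * (D n w)\<^sup>2"
            using sq2[of "K n w - Q n w" "D n w / \<mu>"] by (simp add: power_divide)
        qed
        also have "\<dots> = 2 * expectation (\<lambda>w. (K n w - Q n w)\<^sup>2) + 2 / \<mu>\<^sup>2 * expectation (\<lambda>w. (D n w)\<^sup>2)"
          using KQ2 D2 by simp
        also have "\<dots> \<le> 2 * (C + 3) + 2 / \<mu>\<^sup>2 * expectation (\<lambda>w. (D n w)\<^sup>2)"
          using KQ[of n] elim by simp
        finally have "expectation (\<lambda>w. (K n w - t n / \<mu> - Z n w)\<^sup>2) / t n
            \<le> (2 * (C + 3) + 2 / \<mu>\<^sup>2 * expectation (\<lambda>w. (D n w)\<^sup>2)) / t n"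
          using elim by (intro divide_right_mono) auto
        then show ?case using elim by (simp add: add_divide_distrib)
      qed
    qed
  qed (use t_pos in auto)
  then show ?thesis by (simp add: K_def[abs_def] t_def)
qed

end

section \<open>From stick breaking to the random walk\<close>

text \<open>
  The value 1 outside the unit interval is arbitrary: any positive value makes the steps positive at
  every sample point, and changes them only on a null event, because the fractions lie in the unit
  interval almost surely.
\<close>

definition log_step :: "real \<Rightarrow> real" where
  "log_step x = (if 0 < x \<and> x < 1 then - ln (1 - x) else 1)"

lemma log_step_measurable [measurable]: "log_step \<in> borel_measurable borel"
  unfolding log_step_def by measurable

lemma log_step_pos: "log_step x > 0"
  by (auto simp: log_step_def)

lemma exp_minus_log_step: "0 < x \<Longrightarrow> x < 1 \<Longrightarrow> exp (- log_step x) = 1 - x"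
  by (simp add: log_step_def)

lemma stick_point_eq:
  assumes "\<And>i. i \<ge> 1 \<Longrightarrow> X i w \<in> {0<..<1}"
  shows "stick_point X k w = 1 - exp (- (\<Sum>i<k. log_step (X (Suc i) w)))"
proof -
  have "(\<Prod>i=1..k. (1 - X i w)) = exp (- (\<Sum>i<k. log_step (X (Suc i) w)))"
  proof (induction k)
    case (Suc k)
    have "exp (- log_step (X (Suc k) w)) = 1 - X (Suc k) w"
      using assms[of "Suc k"] by (intro exp_minus_log_step) auto
    with Suc show ?case by (simp add: exp_diff exp_minus field_simps)
  qed simp
  then show ?thesis by (simp add: stick_point_def)
qed

theorem proposition6:
  fixes \<omega> :: "real measure"
    and M :: "'a measure"
    and X U :: "nat \<Rightarrow> 'a \<Rightarrow> real"
    and \<mu> \<nu> \<sigma>2 :: real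
  assumes prob_\<omega>: "prob_space \<omega>"
    and sets_\<omega>: "sets \<omega> = sets borel"
    and \<omega>_on_unit: "measure \<omega> {0<..<1} = 1"
    and not_geometric: "\<not> (\<exists>x\<in>{0<..<1::real}. measure \<omega> {1 - x ^ j | j::nat. j \<ge> 1} = 1)"
    and log_integrable: "set_integrable \<omega> {0<..<1} (\<lambda>x. \<bar>ln x\<bar>)"
    and log_sq_integrable: "set_integrable \<omega> {0<..<1} (\<lambda>x. (ln (1 - x))\<^sup>2)"
    and \<nu>_eq: "\<nu> = (LINT x:{0<..<1}|\<omega>. (ln (1 - x))\<^sup>2)"
    and \<mu>_eq: "\<mu> = (LINT x:{0<..<1}|\<omega>. \<bar>ln (1 - x)\<bar>)"
    and \<sigma>2_eq: "\<sigma>2 = \<nu> - \<mu>\<^sup>2"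
    and prob_M: "prob_space M"
    and X_indep: "prob_space.indep_vars M (\<lambda>_. borel) X {1..}"
    and X_distr: "\<And>j. j \<ge> 1 \<Longrightarrow> distr M borel (X j) = \<omega>"
    and U_indep: "prob_space.indep_vars M (\<lambda>_. borel) U {1..}"
    and U_distr: "\<And>i. i \<ge> 1 \<Longrightarrow> distr M borel (U i) = uniform_measure lborel {0..1}"
    and X_U_indep: "prob_space.indep_var M
           (Pi\<^sub>M {1..} (\<lambda>_. borel)) (\<lambda>w. \<lambda>j\<in>{1..}. X j w)
           (Pi\<^sub>M {1..} (\<lambda>_. borel)) (\<lambda>w. \<lambda>i\<in>{1..}. U i w)"
  shows "(\<lambda>n. prob_space.variance M (\<lambda>w. real (num_occupied X U n w)))
           \<sim>[at_top] (\<lambda>n. \<sigma>2 / \<mu> ^ 3 * ln (real n))"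
proof -
  interpret \<omega>: prob_space \<omega> by (rule prob_\<omega>)
  interpret M: prob_space M by (rule prob_M)
  note [measurable_cong] = sets_\<omega>
  have X_meas: "X j \<in> borel_measurable M" if "j \<ge> 1" for j
  proof -
    have "\<forall>i\<in>{1..}. X i \<in> borel_measurable M"
      using X_indep unfolding M.indep_vars_def by (rule conjunct1)
    then show ?thesis using that by auto
  qed
  have U_meas: "U j \<in> borel_measurable M" if "j \<ge> 1" for j
  proof -
    have "\<forall>i\<in>{1..}. U i \<in> borel_measurable M"
      using U_indep unfolding M.indep_vars_def by (rule conjunct1)
    then show ?thesis using that by auto
  qed
  have \<omega>_AE: "AE x in \<omega>. x \<in> {0<..<1}"
    by (rule \<omega>.AE_prob_1[OF \<omega>_on_unit])
  have X_AE: "AE w in M. X j w \<in> {0<..<1}" if "j \<ge> 1" for j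
  proof -
    have "AE x in distr M borel (X j). x \<in> {0<..<1}" using \<omega>_AE by (simp only: X_distr[OF that])
    then show ?thesis by (subst (asm) AE_distr_iff) (use X_meas[OF that] in auto)
  qed
  have transfer: "integrable M (\<lambda>w. g (X 1 w)) \<longleftrightarrow> set_integrable \<omega> {0<..<1} h"
    "M.expectation (\<lambda>w. g (X 1 w)) = (LINT x:{0<..<1}|\<omega>. h x)"
    if [measurable]: "g \<in> borel_measurable borel" "h \<in> borel_measurable borel"
      and gh: "\<And>x. x \<in> {0<..<1} \<Longrightarrow> g x = h x" for g h :: "real \<Rightarrow> real"
  proof -
    note [measurable] = X_meas[of 1, simplified]
    have eq: "AE x in \<omega>. g x = indicator {0<..<1} x *\<^sub>R h x"
      using \<omega>_AE by eventually_elim (simp add: gh)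
    have "integrable M (\<lambda>w. g (X 1 w)) \<longleftrightarrow> integrable (distr M borel (X 1)) g"
      by (rule integrable_distr_eq[symmetric]) auto
    also have "\<dots> \<longleftrightarrow> integrable \<omega> g" by (simp only: X_distr order_refl)
    also have "\<dots> \<longleftrightarrow> set_integrable \<omega> {0<..<1} h"
      unfolding set_integrable_def by (rule integrable_cong_AE) (use eq in auto)
    finally show "integrable M (\<lambda>w. g (X 1 w)) \<longleftrightarrow> set_integrable \<omega> {0<..<1} h" .
    have "M.expectation (\<lambda>w. g (X 1 w)) = integral\<^sup>L (distr M borel (X 1)) g"
      by (rule integral_distr[symmetric]) auto
    also have "\<dots> = integral\<^sup>L \<omega> g" by (simp only: X_distr order_refl)
    also have "\<dots> = (LINT x:{0<..<1}|\<omega>. h x)"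
      unfolding set_lebesgue_integral_def by (rule integral_cong_AE) (use eq in auto)
    finally show "M.expectation (\<lambda>w. g (X 1 w)) = (LINT x:{0<..<1}|\<omega>. h x)" .
  qed
  define \<xi> where "\<xi> j w = log_step (X j w)" for j w
  interpret W: positive_walk M \<xi>
  proof
    show "M.indep_vars (\<lambda>_. borel) \<xi> {1..}"
      using M.indep_vars_compose2[OF X_indep, of "\<lambda>_. log_step" "\<lambda>_. borel"]
      by (simp add: \<xi>_def[abs_def])
    have law: "distr M borel (\<xi> j) = distr \<omega> borel log_step" if "j \<ge> 1" for j
    proof -
      have "distr \<omega> borel log_step = distr (distr M borel (X j)) borel log_step"
        by (simp only: X_distr[OF that])
      also have "\<dots> = distr M borel (log_step \<circ> X j)"
        by (rule distr_distr) (use X_meas[OF that] in auto)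
      finally show ?thesis by (simp add: \<xi>_def[abs_def] comp_def)
    qed
    show "distr M borel (\<xi> (Suc k)) = distr M borel (\<xi> 1)" for k
      by (simp only: law[of "Suc k"] law[of 1])
    show "\<xi> (Suc k) w > 0" for k w by (simp add: \<xi>_def log_step_pos)
    show "integrable M (\<lambda>w. (\<xi> 1 w)\<^sup>2)"
      unfolding \<xi>_def
      by (subst transfer(1)[of "\<lambda>x. (log_step x)\<^sup>2" "\<lambda>x. (ln (1 - x))\<^sup>2"])
        (use log_sq_integrable in \<open>auto simp: log_step_def\<close>)
  qed
  interpret sieve M \<xi> U
  proof
    show "M.indep_vars (\<lambda>_. borel) U {1..}" by (rule U_indep)
    show "distr M borel (U i) = uniform_measure lborel {0..1}" if "i \<ge> 1" for i
      by (rule U_distr[OF that])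
    have "(\<lambda>x. \<lambda>j\<in>{1..}. log_step (x j)) \<in> PiM {1..} (\<lambda>_. borel) \<rightarrow>\<^sub>M PiM {1::nat..} (\<lambda>_. borel)"
      by measurable
    from M.indep_var_compose[OF X_U_indep this measurable_id]
    show "M.indep_var (PiM {1..} (\<lambda>_. borel)) (\<lambda>w. \<lambda>j\<in>{1..}. \<xi> j w)
        (PiM {1..} (\<lambda>_. borel)) (\<lambda>w. \<lambda>i\<in>{1..}. U i w)"
      by (simp add: comp_def \<xi>_def restrict_def cong: if_cong)
    have "integrable M (\<lambda>w. \<bar>ln (1 - exp (- \<xi> 1 w))\<bar>)"
      unfolding \<xi>_def
      by (subst transfer(1)[of "\<lambda>x. \<bar>ln (1 - exp (- log_step x))\<bar>" "\<lambda>x. \<bar>ln x\<bar>"])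
        (use log_integrable in \<open>auto simp: exp_minus_log_step\<close>)
    then show "integrable M (\<lambda>w. ln (1 - exp (- \<xi> 1 w)))"
      by (subst (asm) integrable_abs_iff) auto
  qed
  have \<mu>: "W.\<mu> = \<mu>"
    unfolding W.\<mu>_def \<mu>_eq \<xi>_def
    by (rule transfer(2)) (auto simp: log_step_def)
  have \<sigma>2: "W.\<sigma>2 = \<sigma>2"
  proof -
    have "M.expectation (\<lambda>w. (\<xi> 1 w)\<^sup>2) = \<nu>"
      unfolding \<nu>_eq \<xi>_def by (rule transfer(2)) (auto simp: log_step_def)
    then show ?thesis by (simp only: W.\<sigma>2_eq \<sigma>2_eq \<mu>)
  qed
  \<comment> \<open>If the variance vanished, the law would be the unit mass at \<open>1 - exp (- \<mu>)\<close>, the first term of a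
    geometric sequence with ratio \<open>exp (- \<mu>)\<close>.\<close>
  have "\<sigma>2 \<noteq> 0"
  proof
    assume "\<sigma>2 = 0"
    have "integrable M (\<lambda>w. (\<xi> 1 w - W.\<mu>)\<^sup>2)"
      using M.integrable_square_add[OF W.step_measurable_1 _ W.square_integrable, of "\<lambda>_. - W.\<mu>"] by simp
    moreover have "M.expectation (\<lambda>w. (\<xi> 1 w - W.\<mu>)\<^sup>2) = 0"
      using \<open>\<sigma>2 = 0\<close> \<sigma>2 unfolding W.\<sigma>2_def by simp
    ultimately have "AE w in M. (\<xi> 1 w - W.\<mu>)\<^sup>2 = 0"
      by (subst integral_nonneg_eq_0_iff_AE[symmetric]) auto
    moreover have "AE w in M. X 1 w \<in> {0<..<1}" by (rule X_AE) simp
    ultimately have "AE w in M. X 1 w = 1 - exp (- \<mu>)"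
    proof eventually_elim
      case (elim w)
      then have "exp (- \<mu>) = 1 - X 1 w"
        using exp_minus_log_step[of "X 1 w"] by (simp add: \<xi>_def \<mu>)
      then show ?case by simp
    qed
    then have "AE x in distr M borel (X 1). x \<in> {1 - exp (- \<mu>)}"
      by (subst AE_distr_iff) (use X_meas[of 1] in auto)
    then have "AE x in \<omega>. x \<in> {1 - exp (- \<mu>)}" by (simp only: X_distr[of 1])
    then have atom: "measure \<omega> {1 - exp (- \<mu>)} = 1"
      by (subst \<omega>.prob_eq_1) (auto simp: sets_\<omega>)
    let ?G = "{1 - exp (- \<mu>) ^ j | j::nat. j \<ge> 1}"
    have "?G = (\<lambda>j. 1 - exp (- \<mu>) ^ j) ` {1..}" by auto
    then have "countable ?G" by simp
    then have "?G \<in> sets \<omega>" unfolding sets_\<omega> by (rule sets.countable[rotated]) auto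
    moreover have "{1 - exp (- \<mu>)} \<subseteq> ?G"
      by (auto intro!: exI[of _ "Suc 0"])
    ultimately have "measure \<omega> ?G \<ge> 1"
      using \<omega>.finite_measure_mono[of "{1 - exp (- \<mu>)}" ?G] atom by simp
    then have "measure \<omega> ?G = 1" using \<omega>.prob_le_1[of ?G] by linarith
    moreover have "exp (- \<mu>) \<in> {0<..<1}" using W.\<mu>_pos \<mu> by simp
    ultimately have "\<exists>x\<in>{0<..<1}. measure \<omega> {1 - x ^ j | j::nat. j \<ge> 1} = 1" by (rule bexI)
    then show False using not_geometric by contradiction
  qed
  \<comment> \<open>The intervals are numbered from 1, the cells from 0.\<close>
  have count: "AE w in M. num_occupied X U n w = card (occupied n w)" for n
  proof -
    have "AE w in M. \<forall>i. X (Suc i) w \<in> {0<..<1}" using X_AE by (simp add: AE_all_countable)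
    then show ?thesis
    proof eventually_elim
      case (elim w)
      have "X i w \<in> {0<..<1}" if "i \<ge> 1" for i using elim that by (cases i) auto
      note sp = stick_point_eq[of X w, OF this]
      have "{j. 1 \<le> j \<and> (\<exists>i\<in>{1..n}. U i w \<in> {stick_point X (j - 1) w<..<stick_point X j w})}
          = Suc ` occupied n w"
      proof (intro equalityI subsetI)
        fix j assume "j \<in> {j. 1 \<le> j \<and> (\<exists>i\<in>{1..n}. U i w \<in> {stick_point X (j - 1) w<..<stick_point X j w})}"
        then show "j \<in> Suc ` occupied n w"
          by (cases j) (auto simp: sp occupied_def cell_def W.S_def \<xi>_def)
      qed (auto simp: sp occupied_def cell_def W.S_def \<xi>_def)
      then show ?case by (simp add: num_occupied_def card_image)
    qed
  qed
  have [measurable]: "(\<lambda>w. real (num_occupied X U n w)) \<in> borel_measurable M" for n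
  proof -
    have [measurable]: "stick_point X k \<in> borel_measurable M" for k
      unfolding stick_point_def using X_meas
      by (intro borel_measurable_diff borel_measurable_prod borel_measurable_const) auto
    have "(\<lambda>w. num_occupied X U n w) \<in> M \<rightarrow>\<^sub>M count_space UNIV"
      unfolding num_occupied_def
    proof (rule measurable_card)
      fix j
      have "{w \<in> space M. j \<in> {j. 1 \<le> j \<and> (\<exists>i\<in>{1..n}. U i w \<in> {stick_point X (j - 1) w<..<stick_point X j w})}}
        = (if 1 \<le> j then \<Union>i\<in>{1..n}. {w \<in> space M. stick_point X (j - 1) w < U i w \<and> U i w < stick_point X j w} else {})"
        by auto
      also have "\<dots> \<in> sets M"
      proof -
        have "{w \<in> space M. stick_point X (j - 1) w < U i w \<and> U i w < stick_point X j w} \<in> sets M" if "i \<in> {1..n}" for i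
        proof -
          have [measurable]: "U i \<in> borel_measurable M" using U_meas that by simp
          show ?thesis by measurable
        qed
        then show ?thesis by (auto intro: sets.finite_UN)
      qed
      finally show "{w \<in> space M. j \<in> {j. 1 \<le> j \<and> (\<exists>i\<in>{1..n}. U i w \<in> {stick_point X (j - 1) w<..<stick_point X j w})}} \<in> sets M" .
    qed
    then show ?thesis by (rule measurable_compose) simp
  qed
  have var: "M.variance (\<lambda>w. real (num_occupied X U n w)) = M.variance (\<lambda>w. real (card (occupied n w)))" for n
  proof -
    have mean: "M.expectation (\<lambda>w. real (num_occupied X U n w)) = M.expectation (\<lambda>w. real (card (occupied n w)))"
    proof (rule integral_cong_AE)
      show "AE w in M. real (num_occupied X U n w) = real (card (occupied n w))"
        using count[of n] by eventually_elim simp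
    qed measurable
    show ?thesis unfolding mean
    proof (rule integral_cong_AE)
      show "AE w in M. (real (num_occupied X U n w) - M.expectation (\<lambda>w. real (card (occupied n w))))\<^sup>2
        = (real (card (occupied n w)) - M.expectation (\<lambda>w. real (card (occupied n w))))\<^sup>2"
        using count[of n] by eventually_elim simp
    qed measurable
  qed
  have "\<sigma>2 / \<mu> ^ 3 \<noteq> 0" using \<open>\<sigma>2 \<noteq> 0\<close> W.\<mu>_pos \<mu> by simp
  with variance_card_occupied show ?thesis
    unfolding var \<mu> \<sigma>2 by (intro asymp_equivI'_const) auto
qed

end
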